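(* Let $G$ be a finite group acting by quiver automorphisms on a finite acyclic quiver $Q$, and let $C$ be the associated Cartan matrix, indexed by $Q_0/G$. Then there is a unique isomorphism of monoids $\psi'\colon WM(C)\to WM(Q)^G$ such that $\psi'\circ\rho_C=\rho_Q^G\circ\psi$ as maps $W(C)\to WM(Q)^G$.
   Context: Associated Cartan matrix: $C=(c_{\mathbf{i},\mathbf{j}})$ has rows and columns indexed by the set $Q_0/G$ of $G$-orbits of vertices, with $c_{\mathbf{i},\mathbf{i}}=2$ and, for $\mathbf{i}\ne\mathbf{j}$, $c_{\mathbf{i},\mathbf{j}}=-N_{\mathbf{i},\mathbf{j}}/|\mathbf{j}|$, where $N_{\mathbf{i},\mathbf{j}}$ is the number of arrows of $Q$ between the orbits $\mathbf{i}$ and $\mathbf{j}$. (There are no arrows between vertices of the same orbit.) Weyl groups: $W(Q)$ is generated by $s_i$ ($i\in Q_0$) with relations $s_i^2=1$; for $i\neq j$, $(s_is_j)^2=1$ if there is no arrow between $i$ and $j$, and $(s_is_j)^3=1$ if there is exactly one. $W(C)$ is generated by $r_{\mathbf{i}}$ with relations $r_{\mathbf{i}}^2=1$ and, for $\mathbf{i}\neq\mathbf{j}$, $(r_{\mathbf{i}}r_{\mathbf{j}})^m=1$ with $m=2,3,4,6$ if $c_{\mathbf{i},\mathbf{j}}c_{\mathbf{j},\mathbf{i}}=0,1,2,3$ respectively (no relation otherwise). Weyl monoids: $WM(Q)$ is the monoid generated by $h_i$ ($i\in Q_0$) with relations $h_i^2=h_i$; for $i\ne j$, $h_ih_j=h_jh_i$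 if there is no arrow between $i$ and $j$, and $h_ih_jh_i=h_jh_ih_j$ if there is exactly one. $WM(C)$ is the monoid generated by $f_{\mathbf{i}}$ with relations $f_{\mathbf{i}}^2=f_{\mathbf{i}}$ and, for $\mathbf{i}\ne\mathbf{j}$: $f_{\mathbf{i}}f_{\mathbf{j}}=f_{\mathbf{j}}f_{\mathbf{i}}$ if $c_{\mathbf{i},\mathbf{j}}=0$; $f_{\mathbf{i}}f_{\mathbf{j}}f_{\mathbf{i}}=f_{\mathbf{j}}f_{\mathbf{i}}f_{\mathbf{j}}$, $(f_{\mathbf{i}}f_{\mathbf{j}})^2=(f_{\mathbf{j}}f_{\mathbf{i}})^2$, $(f_{\mathbf{i}}f_{\mathbf{j}})^3=(f_{\mathbf{j}}f_{\mathbf{i}})^3$ if $c_{\mathbf{i},\mathbf{j}}c_{\mathbf{j},\mathbf{i}}=1,2,3$ respectively. Known bijections (Tsaranov): $\rho_Q\colon W(Q)\to WM(Q)$, sending $s_{i_1}\cdots s_{i_n}$ to $h_{i_1}\cdots h_{i_n}$ for every reduced expression; and $\rho_C\colon W(C)\to WM(C)$, sending $r_{\mathbf{i}_1}\cdots r_{\mathbf{i}_m}$ to $f_{\mathbf{i}_1}\cdots f_{\mathbf{i}_m}$ for every reduced expression. $G$ acts on $W(Q)$ and $WM(Q)$ by $g(s_i)=s_{g(i)}$, $g(h_i)=h_{g(i)}$; $W(Q)^G$ and $WM(Q)^G$ are the subgroup, resp. submonoid, of $G$-invariant elements. $\rho_Q$ is compatible with the actions and restricts to a bijection $\rho_Q^G\colon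 W(Q)^G\to WM(Q)^G$. There is a known group isomorphism $\psi\colon W(C)\to W(Q)^G$ with $\psi(r_{\mathbf{i}})=\prod_{i\in\mathbf{i}}s_i$. *)

theory Defs
  imports "HOL-Algebra.Group_Action" "Graph_Theory.Arc_Walk"
begin

section \<open>Quivers with a group action and their Cartan matrices\<close>

text \<open>Multiple arrows are allowed. Acyclic means that there is no oriented cycle, loops
  included: \<open>pre_digraph.cycle\<close> only requires a nonempty closed walk without repeated vertices.\<close>

locale quiver_action =
  fin_digraph Q + vertices: group_action G "verts Q" \<alpha> + arrows: group_action G "arcs Q" \<beta>
  for G :: "('g, 'k) monoid_scheme" and Q :: "('v, 'e) pre_digraph"
    and \<alpha> :: "'g \<Rightarrow> 'v \<Rightarrow> 'v" and \<beta> :: "'g \<Rightarrow> 'e \<Rightarrow> 'e" +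
  assumes finite_group: "finite (carrier G)"
    and acyclic: "\<not> (\<exists>p. pre_digraph.cycle Q p)"
    and tail_action: "g \<in> carrier G \<Longrightarrow> e \<in> arcs Q \<Longrightarrow> tail Q (\<beta> g e) = \<alpha> g (tail Q e)"
    and head_action: "g \<in> carrier G \<Longrightarrow> e \<in> arcs Q \<Longrightarrow> head Q (\<beta> g e) = \<alpha> g (head Q e)"

definition arrows_between :: "('v, 'e) pre_digraph \<Rightarrow> 'v set \<Rightarrow> 'v set \<Rightarrow> nat" where
  "arrows_between Q A B = card {e \<in> arcs Q.
     tail Q e \<in> A \<and> head Q e \<in> B \<or> tail Q e \<in> B \<and> head Q e \<in> A}"

definition cartan :: "('v, 'e) pre_digraph \<Rightarrow> 'v set \<Rightarrow> 'v set \<Rightarrow> rat" where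
  "cartan Q A B = (if A = B then 2 else - of_nat (arrows_between Q A B) / of_nat (card B))"


section \<open>Presentations of monoids and groups\<close>

text \<open>The congruence on the free monoid \<open>lists S\<close> generated by the pairs in \<open>R\<close>.\<close>

inductive pres_eq :: "'a set \<Rightarrow> ('a list \<times> 'a list) set \<Rightarrow> 'a list \<Rightarrow> 'a list \<Rightarrow> bool"
  for S R where
  refl: "u \<in> lists S \<Longrightarrow> pres_eq S R u u"
| sym: "pres_eq S R u v \<Longrightarrow> pres_eq S R v u"
| trans: "pres_eq S R u v \<Longrightarrow> pres_eq S R v w \<Longrightarrow> pres_eq S R u w"
| rel: "(u, v) \<in> R \<Longrightarrow> u \<in> lists S \<Longrightarrow> v \<in> lists S \<Longrightarrow> p \<in> lists S \<Longrightarrow> q \<in> lists S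
    \<Longrightarrow> pres_eq S R (p @ u @ q) (p @ v @ q)"

definition pres_class :: "'a set \<Rightarrow> ('a list \<times> 'a list) set \<Rightarrow> 'a list \<Rightarrow> 'a list set" where
  "pres_class S R u = {v. pres_eq S R u v}"

definition presented_monoid :: "'a set \<Rightarrow> ('a list \<times> 'a list) set \<Rightarrow> 'a list set monoid" where
  "presented_monoid S R =
     \<lparr>carrier = pres_class S R ` lists S,
      mult = (\<lambda>X Y. {w. \<exists>u\<in>X. \<exists>v\<in>Y. pres_eq S R (u @ v) w}),
      one = pres_class S R []\<rparr>"

text \<open>Group words have letters \<open>(a, True)\<close> for the generator \<open>a\<close> and \<open>(a, False)\<close> for its
  inverse; \<open>R\<close> is a set of relators.\<close>

definition group_rels :: "('a \<times> bool) list set \<Rightarrow> (('a \<times> bool) list \<times> ('a \<times> bool) list) set" where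
  "group_rels R = {(r, []) | r. r \<in> R} \<union> {([(a, b), (a, \<not> b)], []) | a b. True}"

definition presented_group ::
    "'a set \<Rightarrow> ('a \<times> bool) list set \<Rightarrow> ('a \<times> bool) list set monoid" where
  "presented_group S R = presented_monoid (S \<times> UNIV) (group_rels R)"

lemma pres_eq_lists: "pres_eq S R u v \<Longrightarrow> u \<in> lists S \<and> v \<in> lists S"
  by (induction rule: pres_eq.induct) auto

lemma pres_eq_append:
  assumes "pres_eq S R u v" "p \<in> lists S" "q \<in> lists S"
  shows "pres_eq S R (p @ u @ q) (p @ v @ q)"
  using assms
proof (induction rule: pres_eq.induct)
  case (refl u)
  then show ?case by (intro pres_eq.refl) auto
next
  case (sym u v)
  then show ?case by (blast intro: pres_eq.sym)
next
  case (trans u v w)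
  then show ?case by (blast intro: pres_eq.trans)
next
  case (rel u v p' q')
  then show ?case using pres_eq.rel[of u v R S "p @ p'" "q' @ q"] by simp
qed

lemma presented_monoid_mult:
  assumes "u \<in> lists S" "v \<in> lists S"
  shows "pres_class S R u \<otimes>\<^bsub>presented_monoid S R\<^esub> pres_class S R v = pres_class S R (u @ v)"
proof -
  have "pres_eq S R (u @ v) (u' @ v')" if "pres_eq S R u u'" "pres_eq S R v v'" for u' v'
    using pres_eq_append[OF that(1), of "[]" v] pres_eq_append[OF that(2), of u' "[]"]
      assms pres_eq_lists[OF that(1)] pres_eq.trans by fastforce
  then show ?thesis
    using assms
    by (auto simp: presented_monoid_def pres_class_def intro: pres_eq.refl pres_eq.trans)
qed

lemma monoid_presented_monoid: "monoid (presented_monoid S R)"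
proof
  have c: "x \<in> carrier (presented_monoid S R) \<longleftrightarrow> (\<exists>u\<in>lists S. x = pres_class S R u)" for x
    by (auto simp: presented_monoid_def)
  have o: "\<one>\<^bsub>presented_monoid S R\<^esub> = pres_class S R []"
    by (simp add: presented_monoid_def)
  fix x y z
  let ?M = "presented_monoid S R"
  show "\<one>\<^bsub>?M\<^esub> \<in> carrier ?M" by (auto simp: c o)
  assume "x \<in> carrier ?M"
  then obtain u where u: "u \<in> lists S" "x = pres_class S R u" by (auto simp: c)
  show "\<one>\<^bsub>?M\<^esub> \<otimes>\<^bsub>?M\<^esub> x = x" "x \<otimes>\<^bsub>?M\<^esub> \<one>\<^bsub>?M\<^esub> = x"
    using presented_monoid_mult[of "[]" S u] presented_monoid_mult[of u S "[]"] u
    by (simp_all add: o)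
  assume "y \<in> carrier ?M"
  then obtain v where v: "v \<in> lists S" "y = pres_class S R v" by (auto simp: c)
  have uv: "u @ v \<in> lists S" using u v by auto
  show "x \<otimes>\<^bsub>?M\<^esub> y \<in> carrier ?M"
    using uv by (simp only: u v presented_monoid_mult c) blast
  assume "z \<in> carrier ?M"
  then obtain w where w: "w \<in> lists S" "z = pres_class S R w" by (auto simp: c)
  have vw: "v @ w \<in> lists S" using v w by auto
  show "x \<otimes>\<^bsub>?M\<^esub> y \<otimes>\<^bsub>?M\<^esub> z = x \<otimes>\<^bsub>?M\<^esub> (y \<otimes>\<^bsub>?M\<^esub> z)"
    using presented_monoid_mult[OF uv w(1), of R] presented_monoid_mult[OF u(1) vw, of R]
      presented_monoid_mult[OF u(1) v(1), of R] presented_monoid_mult[OF v(1) w(1), of R]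
    by (simp add: u v w)
qed

lemma group_presented_group: "group (presented_group S R)"
proof -
  define T where "T = S \<times> (UNIV :: bool set)"
  define E where "E = group_rels R"
  let ?M = "presented_monoid T E"
  interpret monoid ?M by (rule monoid_presented_monoid)
  have inv: "\<exists>v\<in>lists T. pres_eq T E (v @ u) [] \<and> pres_eq T E (u @ v) []" if "u \<in> lists T" for u
    using that
  proof (induction u)
    case Nil
    then show ?case by (auto intro: pres_eq.refl)
  next
    case (Cons x u)
    obtain a b where x: "x = (a, b)" by (cases x)
    let ?y = "(a, \<not> b)"
    have xT: "x \<in> T" "?y \<in> T" "u \<in> lists T"
      using Cons.hyps Cons.prems by (simp_all add: x T_def)
    obtain v where v: "v \<in> lists T" "pres_eq T E (v @ u) []" "pres_eq T E (u @ v) []"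
      using Cons.IH xT by auto
    have r: "([x, ?y], []) \<in> E" "([?y, x], []) \<in> E"
      by (auto simp: E_def group_rels_def x)
    have "pres_eq T E (v @ [?y, x] @ u) (v @ [] @ u)"
      using r xT v by (intro pres_eq.rel) auto
    then have 1: "pres_eq T E ((v @ [?y]) @ x # u) []"
      using v by (auto intro: pres_eq.trans)
    have "pres_eq T E ([x] @ (u @ v) @ [?y]) ([x] @ [] @ [?y])"
      using xT v by (intro pres_eq_append) auto
    moreover have "pres_eq T E ([] @ [x, ?y] @ []) ([] @ [] @ [])"
      using r xT by (intro pres_eq.rel) auto
    ultimately have 2: "pres_eq T E ((x # u) @ v @ [?y]) []"
      by (auto intro: pres_eq.trans)
    have 3: "v @ [?y] \<in> lists T" using v xT by auto
    show ?case
      using 1 2 3 by (intro bexI[where x = "v @ [?y]"]) auto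
  qed
  have cl: "pres_class T E u = pres_class T E v" if "pres_eq T E u v" for u v
    using that by (auto simp: pres_class_def intro: pres_eq.sym pres_eq.trans)
  have "group ?M"
  proof (rule group_l_invI)
    fix x assume "x \<in> carrier ?M"
    then obtain u where u: "u \<in> lists T" "x = pres_class T E u" by (auto simp: presented_monoid_def)
    then obtain v where v: "v \<in> lists T" "pres_eq T E (v @ u) []" using inv by blast
    have "pres_class T E v \<otimes>\<^bsub>?M\<^esub> x = \<one>\<^bsub>?M\<^esub>"
      using presented_monoid_mult[OF v(1) u(1), of E] cl[OF v(2)] u
      by (simp add: presented_monoid_def)
    moreover have "pres_class T E v \<in> carrier ?M" using v by (simp add: presented_monoid_def)
    ultimately show "\<exists>y\<in>carrier ?M. y \<otimes>\<^bsub>?M\<^esub> x = \<one>\<^bsub>?M\<^esub>" by blast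
  qed
  then show ?thesis by (simp add: presented_group_def T_def E_def)
qed


section \<open>Weyl groups and Weyl monoids\<close>

fun alt_word :: "nat \<Rightarrow> 'a \<Rightarrow> 'a \<Rightarrow> 'a list" where
  "alt_word 0 a b = []"
| "alt_word (Suc n) a b = a # alt_word n b a"

text \<open>A function \<open>m\<close> prescribes the exponents; \<open>m a b = 0\<close> encodes the absence of a relation
  between \<open>a\<close> and \<open>b\<close> (both families below then contribute a trivial one).\<close>

definition weyl_group_rels :: "'a set \<Rightarrow> ('a \<Rightarrow> 'a \<Rightarrow> nat) \<Rightarrow> ('a \<times> bool) list set" where
  "weyl_group_rels S m =
     {[(a, True), (a, True)] | a. a \<in> S} \<union>
     {concat (replicate (m a b) [(a, True), (b, True)]) | a b. a \<in> S \<and> b \<in> S \<and> a \<noteq> b}"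

definition weyl_group :: "'a set \<Rightarrow> ('a \<Rightarrow> 'a \<Rightarrow> nat) \<Rightarrow> ('a \<times> bool) list set monoid" where
  "weyl_group S m = presented_group S (weyl_group_rels S m)"

definition weyl_gen :: "'a set \<Rightarrow> ('a \<Rightarrow> 'a \<Rightarrow> nat) \<Rightarrow> 'a \<Rightarrow> ('a \<times> bool) list set" where
  "weyl_gen S m a = pres_class (S \<times> UNIV) (group_rels (weyl_group_rels S m)) [(a, True)]"

text \<open>The braid relations equate the two alternating words of length \<open>m a b\<close>; for even exponents
  \<open>2 k\<close> this is \<open>(f\<^sub>a f\<^sub>b)\<^sup>k = (f\<^sub>b f\<^sub>a)\<^sup>k\<close>.\<close>

definition weyl_monoid_rels :: "'a set \<Rightarrow> ('a \<Rightarrow> 'a \<Rightarrow> nat) \<Rightarrow> ('a list \<times> 'a list) set" where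
  "weyl_monoid_rels S m =
     {([a, a], [a]) | a. a \<in> S} \<union>
     {(alt_word (m a b) a b, alt_word (m a b) b a) | a b. a \<in> S \<and> b \<in> S \<and> a \<noteq> b}"

definition weyl_monoid :: "'a set \<Rightarrow> ('a \<Rightarrow> 'a \<Rightarrow> nat) \<Rightarrow> 'a list set monoid" where
  "weyl_monoid S m = presented_monoid S (weyl_monoid_rels S m)"

definition weyl_monoid_gen :: "'a set \<Rightarrow> ('a \<Rightarrow> 'a \<Rightarrow> nat) \<Rightarrow> 'a \<Rightarrow> 'a list set" where
  "weyl_monoid_gen S m a = pres_class S (weyl_monoid_rels S m) [a]"

definition quiver_exp :: "('v, 'e) pre_digraph \<Rightarrow> 'v \<Rightarrow> 'v \<Rightarrow> nat" where
  "quiver_exp Q i j =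
     (if arrows_between Q {i} {j} = 0 then 2
      else if arrows_between Q {i} {j} = 1 then 3
      else 0)"

text \<open>\<open>cartan Q A B * cartan Q B A = 0\<close> is equivalent to \<open>cartan Q A B = 0\<close>, both entries being
  nonzero multiples of the same number of arrows.\<close>

definition cartan_exp :: "('v, 'e) pre_digraph \<Rightarrow> 'v set \<Rightarrow> 'v set \<Rightarrow> nat" where
  "cartan_exp Q A B =
     (let p = cartan Q A B * cartan Q B A in
      if p = 0 then 2 else if p = 1 then 3 else if p = 2 then 4 else if p = 3 then 6 else 0)"


section \<open>Reduced expressions and Tsaranov's bijection\<close>

definition word_prod :: "('x, 'r) monoid_scheme \<Rightarrow> ('a \<Rightarrow> 'x) \<Rightarrow> 'a list \<Rightarrow> 'x" where
  "word_prod M f as = foldr (\<lambda>a x. f a \<otimes>\<^bsub>M\<^esub> x) as \<one>\<^bsub>M\<^esub>"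

definition reduced_word :: "'a set \<Rightarrow> ('a \<Rightarrow> 'a \<Rightarrow> nat) \<Rightarrow> 'a list \<Rightarrow> bool" where
  "reduced_word S m as \<longleftrightarrow> as \<in> lists S \<and>
     (\<forall>bs\<in>lists S. word_prod (weyl_group S m) (weyl_gen S m) bs =
                  word_prod (weyl_group S m) (weyl_gen S m) as \<longrightarrow> length as \<le> length bs)"

text \<open>As every element of the Weyl group has a reduced expression, at most one map on its
  carrier satisfies this.\<close>

definition tsaranov_bijection ::
    "'a set \<Rightarrow> ('a \<Rightarrow> 'a \<Rightarrow> nat) \<Rightarrow> (('a \<times> bool) list set \<Rightarrow> 'a list set) \<Rightarrow> bool" where
  "tsaranov_bijection S m \<rho> \<longleftrightarrow>
     bij_betw \<rho> (carrier (weyl_group S m)) (carrier (weyl_monoid S m)) \<and>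
     (\<forall>as. reduced_word S m as \<longrightarrow>
        \<rho> (word_prod (weyl_group S m) (weyl_gen S m) as) =
        word_prod (weyl_monoid S m) (weyl_monoid_gen S m) as)"


section \<open>The groups and monoids of a quiver with a group action\<close>

abbreviation WQ :: "('v, 'e) pre_digraph \<Rightarrow> ('v \<times> bool) list set monoid" where
  "WQ Q \<equiv> weyl_group (verts Q) (quiver_exp Q)"

abbreviation WMQ :: "('v, 'e) pre_digraph \<Rightarrow> 'v list set monoid" where
  "WMQ Q \<equiv> weyl_monoid (verts Q) (quiver_exp Q)"

text \<open>Elements of the Weyl group and of the Weyl monoid are classes of words; a group element
  moves such a class by being applied to every letter of every word in it.\<close>

definition WQ_act :: "('g \<Rightarrow> 'v \<Rightarrow> 'v) \<Rightarrow> 'g \<Rightarrow> ('v \<times> bool) list set \<Rightarrow> ('v \<times> bool) list set" where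
  "WQ_act \<alpha> g X = map (map_prod (\<alpha> g) id) ` X"

definition WMQ_act :: "('g \<Rightarrow> 'v \<Rightarrow> 'v) \<Rightarrow> 'g \<Rightarrow> 'v list set \<Rightarrow> 'v list set" where
  "WMQ_act \<alpha> g X = map (\<alpha> g) ` X"

definition WQ_inv ::
    "('g, 'k) monoid_scheme \<Rightarrow> ('v, 'e) pre_digraph \<Rightarrow> ('g \<Rightarrow> 'v \<Rightarrow> 'v) \<Rightarrow>
     ('v \<times> bool) list set monoid" where
  "WQ_inv G Q \<alpha> =
     (WQ Q)\<lparr>carrier := {X \<in> carrier (WQ Q). \<forall>g\<in>carrier G. WQ_act \<alpha> g X = X}\<rparr>"

definition WMQ_inv ::
    "('g, 'k) monoid_scheme \<Rightarrow> ('v, 'e) pre_digraph \<Rightarrow> ('g \<Rightarrow> 'v \<Rightarrow> 'v) \<Rightarrow> 'v list set monoid" where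
  "WMQ_inv G Q \<alpha> =
     (WMQ Q)\<lparr>carrier := {X \<in> carrier (WMQ Q). \<forall>g\<in>carrier G. WMQ_act \<alpha> g X = X}\<rparr>"

abbreviation WC ::
    "('g, 'k) monoid_scheme \<Rightarrow> ('v, 'e) pre_digraph \<Rightarrow> ('g \<Rightarrow> 'v \<Rightarrow> 'v) \<Rightarrow>
     ('v set \<times> bool) list set monoid" where
  "WC G Q \<alpha> \<equiv> weyl_group (orbits G (verts Q) \<alpha>) (cartan_exp Q)"

abbreviation WMC ::
    "('g, 'k) monoid_scheme \<Rightarrow> ('v, 'e) pre_digraph \<Rightarrow> ('g \<Rightarrow> 'v \<Rightarrow> 'v) \<Rightarrow> 'v set list set monoid" where
  "WMC G Q \<alpha> \<equiv> weyl_monoid (orbits G (verts Q) \<alpha>) (cartan_exp Q)"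

text \<open>The product of the generators in an orbit is taken along every enumeration of the orbit;
  the factors commute, since no arrow joins two vertices of the same orbit.\<close>

definition folding_iso ::
    "('g, 'k) monoid_scheme \<Rightarrow> ('v, 'e) pre_digraph \<Rightarrow> ('g \<Rightarrow> 'v \<Rightarrow> 'v) \<Rightarrow>
     (('v set \<times> bool) list set \<Rightarrow> ('v \<times> bool) list set) \<Rightarrow> bool" where
  "folding_iso G Q \<alpha> \<psi> \<longleftrightarrow>
     \<psi> \<in> iso (WC G Q \<alpha>) (WQ_inv G Q \<alpha>) \<and>
     (\<forall>A\<in>orbits G (verts Q) \<alpha>. \<forall>is. distinct is \<and> set is = A \<longrightarrow>
        \<psi> (weyl_gen (orbits G (verts Q) \<alpha>) (cartan_exp Q) A) =
        word_prod (WQ Q) (weyl_gen (verts Q) (quiver_exp Q)) is)"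

end

theory Submission
  imports Defs
begin

text \<open>
  Since \<open>\<rho>C\<close> is bijective, the only candidate is \<open>\<psi>' = \<rho>Q \<circ> \<psi> \<circ> \<rho>C\<inverse>\<close>. It is a bijection onto the
  invariants because \<open>\<rho>Q\<close> is equivariant: a symmetry of the quiver preserves length, hence sends
  reduced words to reduced words (\<open>rho_invariant_iff\<close>). The content is that \<open>\<psi>'\<close> is multiplicative.

  The mere existence of a Tsaranov bijection \<open>\<rho>\<close> already gives the structure of Coxeter groups that
  is needed. Relators have even length, so \<open>s\<^sub>a x\<close> is one longer or one shorter than \<open>x\<close>; appending
  \<open>a\<close> to a reduced word shows that \<open>h\<^sub>a \<rho>(x)\<close> is \<open>\<rho>(s\<^sub>a x)\<close> in the first case, in which \<open>a\<close> is called
  an ascent of \<open>x\<close>, and \<open>\<rho>(x)\<close> in the second. Left and right multiplication in the monoid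
  commute and \<open>\<rho>\<close> is injective, and this yields the exchange property (\<open>exchange\<close>).

  Write \<open>r\<^sub>A\<close>, \<open>f\<^sub>A\<close> for the generators indexed by an orbit \<open>A\<close>, so that \<open>\<psi>(r\<^sub>A) = \<Prod>\<^sub>i\<^sub>\<in>\<^sub>A s\<^sub>i\<close>. In
  view of the two cases above, multiplicativity of \<open>\<psi>'\<close> amounts to this: if \<open>A\<close> is an ascent of
  \<open>w\<close>, then the product over \<open>A\<close> lengthens \<open>\<psi>(w)\<close> by \<open>|A|\<close>, and otherwise every \<open>h\<^sub>i\<close> with \<open>i \<in> A\<close>
  fixes \<open>\<rho>Q(\<psi>(w))\<close>. The heart is therefore \<open>ascent_block\<close>: if \<open>A\<close> is an ascent of \<open>w\<close>, then every
  \<open>i \<in> A\<close> is an ascent of \<open>\<psi>(w)\<close>. Build \<open>w\<close> up letter by letter and suppose that this first fails when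
  \<open>w'\<close> becomes \<open>w = w' r\<^sub>B\<close>. By the exchange property \<open>s\<^sub>i \<psi>(w') = \<psi>(w') s\<^sub>j\<close> for some \<open>j \<in> B\<close>. As
  \<open>\<psi>(w')\<close> is invariant, the group carries this identity to all of \<open>A\<close> and \<open>B\<close>
  (\<open>conjugate_block\<close>), so that \<open>r\<^sub>A w' = w' r\<^sub>B = w\<close> and \<open>r\<^sub>A w = w'\<close> is shorter than \<open>w\<close>, a
  contradiction.
\<close>


section \<open>Products along words\<close>

declare in_lists_conv_set [simp]

lemma word_prod_Nil [simp]: "word_prod M f [] = \<one>\<^bsub>M\<^esub>"
  by (simp add: word_prod_def)

lemma word_prod_Cons [simp]: "word_prod M f (a # as) = f a \<otimes>\<^bsub>M\<^esub> word_prod M f as"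
  by (simp add: word_prod_def)

lemma (in monoid) word_prod_closed:
  "f \<in> A \<rightarrow> carrier G \<Longrightarrow> as \<in> lists A \<Longrightarrow> word_prod G f as \<in> carrier G"
  by (induction as) auto

lemma (in monoid) word_prod_append:
  "f \<in> A \<rightarrow> carrier G \<Longrightarrow> as \<in> lists A \<Longrightarrow> bs \<in> lists A \<Longrightarrow>
     word_prod G f (as @ bs) = word_prod G f as \<otimes> word_prod G f bs"
  by (induction as) (auto simp: word_prod_closed m_assoc Pi_iff)

lemma (in monoid) word_prod_hom:
  assumes "\<phi> \<in> hom G H" "\<phi> \<one> = \<one>\<^bsub>H\<^esub>" "f \<in> A \<rightarrow> carrier G" "\<And>a. a \<in> A \<Longrightarrow> \<phi> (f a) = f' (\<pi> a)"
    and "as \<in> lists A"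
  shows "\<phi> (word_prod G f as) = word_prod H f' (map \<pi> as)"
  using assms(5)
proof (induction as)
  case (Cons a as)
  then have "f a \<in> carrier G" "word_prod G f as \<in> carrier G"
    using assms(3) by (auto simp: word_prod_closed)
  then show ?case using Cons assms(1,4) by (simp add: hom_mult)
qed (use assms in simp)

section \<open>Length and ascents in a group with a Tsaranov bijection\<close>

text \<open>A Weyl group, its Weyl monoid and their Tsaranov bijection, detached from the presentations.
  The assumption on parity says that the sign character exists.\<close>
locale tsaranov_system = W: group W + M: monoid M
  for W :: "('x, 'r) monoid_scheme" (structure) and M :: "('y, 't) monoid_scheme"
    and S :: "'a set" and s :: "'a \<Rightarrow> 'x" and h :: "'a \<Rightarrow> 'y" and \<rho> :: "'x \<Rightarrow> 'y" +
  assumes s_Pi: "s \<in> S \<rightarrow> carrier W"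
    and generated: "x \<in> carrier W \<Longrightarrow> \<exists>as\<in>lists S. word_prod W s as = x"
    and s_square: "a \<in> S \<Longrightarrow> s a \<otimes> s a = \<one>"
    and parity: "as \<in> lists S \<Longrightarrow> bs \<in> lists S \<Longrightarrow> word_prod W s as = word_prod W s bs \<Longrightarrow>
      even (length as) = even (length bs)"
    and h_Pi: "h \<in> S \<rightarrow> carrier M"
    and h_idem: "a \<in> S \<Longrightarrow> h a \<otimes>\<^bsub>M\<^esub> h a = h a"
    and rho_inj: "inj_on \<rho> (carrier W)"
    and rho_reduced: "as \<in> lists S \<Longrightarrow>
      (\<forall>bs\<in>lists S. word_prod W s bs = word_prod W s as \<longrightarrow> length as \<le> length bs) \<Longrightarrow>
      \<rho> (word_prod W s as) = word_prod M h as"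
begin

definition len :: "'x \<Rightarrow> nat" where
  "len x = (LEAST n. \<exists>as\<in>lists S. length as = n \<and> word_prod W s as = x)"

definition ascent :: "'a \<Rightarrow> 'x \<Rightarrow> bool" where
  "ascent a x \<longleftrightarrow> len x < len (s a \<otimes> x)"

lemma s_closed [simp]: "a \<in> S \<Longrightarrow> s a \<in> carrier W"
  using s_Pi by auto

lemma h_closed [simp]: "a \<in> S \<Longrightarrow> h a \<in> carrier M"
  using h_Pi by auto

lemma wp_closed [simp]: "as \<in> lists S \<Longrightarrow> word_prod W s as \<in> carrier W"
  by (rule W.word_prod_closed[OF s_Pi])

lemma wp_append: "as \<in> lists S \<Longrightarrow> bs \<in> lists S \<Longrightarrow>
    word_prod W s (as @ bs) = word_prod W s as \<otimes> word_prod W s bs"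
  by (rule W.word_prod_append[OF s_Pi])

lemma hp_closed [simp]: "as \<in> lists S \<Longrightarrow> word_prod M h as \<in> carrier M"
  by (rule M.word_prod_closed[OF h_Pi])

lemma inv_s [simp]: "a \<in> S \<Longrightarrow> inv (s a) = s a"
  by (rule W.inv_equality) (auto simp: s_square)

lemma s_cancel [simp]: "a \<in> S \<Longrightarrow> x \<in> carrier W \<Longrightarrow> s a \<otimes> (s a \<otimes> x) = x"
  by (simp add: W.m_assoc[symmetric] s_square)

lemma wp_rev: "as \<in> lists S \<Longrightarrow> word_prod W s (rev as) = inv (word_prod W s as)"
  by (induction as) (auto simp: wp_append W.inv_mult_group)

lemma len_le: "as \<in> lists S \<Longrightarrow> len (word_prod W s as) \<le> length as"
  unfolding len_def by (rule Least_le) blast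

lemma reduced_exists:
  assumes "x \<in> carrier W"
  shows "\<exists>as\<in>lists S. length as = len x \<and> word_prod W s as = x"
proof -
  have "\<exists>n. \<exists>as\<in>lists S. length as = n \<and> word_prod W s as = x"
    using generated[OF assms] by blast
  then show ?thesis unfolding len_def by (rule LeastI_ex)
qed

lemma rho_word:
  "as \<in> lists S \<Longrightarrow> length as = len (word_prod W s as) \<Longrightarrow> \<rho> (word_prod W s as) = word_prod M h as"
  using len_le by (intro rho_reduced) metis+

lemma rho_closed [simp]: "x \<in> carrier W \<Longrightarrow> \<rho> x \<in> carrier M"
  using reduced_exists[of x] rho_word hp_closed by metis

lemma len_one [simp]: "len \<one> = 0"
  using len_le[of "[]"] by simp

lemma len_eq_0: "x \<in> carrier W \<Longrightarrow> len x = 0 \<longleftrightarrow> x = \<one>"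
  using reduced_exists[of x] by auto

lemma rho_one [simp]: "\<rho> \<one> = \<one>\<^bsub>M\<^esub>"
  using rho_word[of "[]"] by simp

lemma len_inv:
  assumes "x \<in> carrier W"
  shows "len (inv x) = len x"
proof -
  have le: "len (inv y) \<le> len y" if y: "y \<in> carrier W" for y
  proof -
    obtain as where "as \<in> lists S" "length as = len y" "word_prod W s as = y"
      using reduced_exists[OF y] by blast
    then show ?thesis using len_le[of "rev as"] by (auto simp: wp_rev)
  qed
  show ?thesis using le[of x] le[of "inv x"] assms by simp
qed

lemma even_len: "as \<in> lists S \<Longrightarrow> even (len (word_prod W s as)) = even (length as)"
  using parity[of _ as] reduced_exists[OF wp_closed] by metis

text \<open>The length changes by at most one, and it changes parity.\<close>
lemma len_s:
  assumes "a \<in> S" "x \<in> carrier W"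
  shows "len (s a \<otimes> x) = Suc (len x) \<or> len x = Suc (len (s a \<otimes> x))"
proof -
  have le: "len (s a \<otimes> y) \<le> Suc (len y)" if y: "y \<in> carrier W" for y
  proof -
    obtain as where "as \<in> lists S" "length as = len y" "word_prod W s as = y"
      using reduced_exists[OF y] by blast
    then show ?thesis using len_le[of "a # as"] assms by auto
  qed
  obtain as where as: "as \<in> lists S" "length as = len x" "word_prod W s as = x"
    using reduced_exists[OF assms(2)] by blast
  have "even (len (s a \<otimes> x)) \<longleftrightarrow> \<not> even (len x)"
    using even_len[of "a # as"] as assms by simp
  then have "len (s a \<otimes> x) \<noteq> len x" by auto
  then show ?thesis using le[of x] le[of "s a \<otimes> x"] assms by auto
qed

lemma len_s_right:
  assumes "a \<in> S" "x \<in> carrier W"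
  shows "len (x \<otimes> s a) = Suc (len x) \<or> len x = Suc (len (x \<otimes> s a))"
  using len_s[of a "inv x"] len_inv[of x] len_inv[of "x \<otimes> s a"] assms
  by (simp add: W.inv_mult_group)

lemma ascent_iff: "a \<in> S \<Longrightarrow> x \<in> carrier W \<Longrightarrow> ascent a x \<longleftrightarrow> len (s a \<otimes> x) = Suc (len x)"
  using len_s[of a x] by (auto simp: ascent_def)

lemma ascent_s: "a \<in> S \<Longrightarrow> x \<in> carrier W \<Longrightarrow> ascent a (s a \<otimes> x) \<longleftrightarrow> \<not> ascent a x"
  using len_s[of a x] by (auto simp: ascent_def)

lemma rho_ascent:
  assumes "a \<in> S" "x \<in> carrier W" "ascent a x"
  shows "\<rho> (s a \<otimes> x) = h a \<otimes>\<^bsub>M\<^esub> \<rho> x"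
proof -
  obtain as where as: "as \<in> lists S" "length as = len x" "word_prod W s as = x"
    using reduced_exists[OF assms(2)] by blast
  then show ?thesis
    using rho_word[of as] rho_word[of "a # as"] assms by (simp add: ascent_iff)
qed

text \<open>At a descent some reduced word of \<open>x\<close> begins with \<open>a\<close>, and \<open>h\<^sub>a\<close> is idempotent.\<close>
lemma rho_descent:
  assumes "a \<in> S" "x \<in> carrier W" "\<not> ascent a x"
  shows "h a \<otimes>\<^bsub>M\<^esub> \<rho> x = \<rho> x"
proof -
  have "\<rho> x = h a \<otimes>\<^bsub>M\<^esub> \<rho> (s a \<otimes> x)"
    using rho_ascent[of a "s a \<otimes> x"] assms ascent_s[of a x] by simp
  then show ?thesis using assms by (simp add: M.m_assoc[symmetric] h_idem)
qed

lemma rho_right_ascent: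
  assumes "a \<in> S" "x \<in> carrier W" "len x < len (x \<otimes> s a)"
  shows "\<rho> (x \<otimes> s a) = \<rho> x \<otimes>\<^bsub>M\<^esub> h a"
proof -
  obtain as where as: "as \<in> lists S" "length as = len x" "word_prod W s as = x"
    using reduced_exists[OF assms(2)] by blast
  have l: "len (x \<otimes> s a) = Suc (len x)" using len_s_right[of a x] assms by auto
  have "word_prod W s (as @ [a]) = x \<otimes> s a" using as assms by (simp add: wp_append)
  moreover have "word_prod M h (as @ [a]) = word_prod M h as \<otimes>\<^bsub>M\<^esub> h a"
    using M.word_prod_append[OF h_Pi as(1), of "[a]"] assms by simp
  ultimately show ?thesis
    using rho_word[of as] rho_word[of "as @ [a]"] as l assms by simp
qed

lemma rho_right_descent:
  assumes "a \<in> S" "x \<in> carrier W" "len (x \<otimes> s a) < len x"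
  shows "\<rho> x \<otimes>\<^bsub>M\<^esub> h a = \<rho> x"
proof -
  have x: "x \<otimes> s a \<otimes> s a = x" using assms by (simp add: W.m_assoc s_square)
  have "\<rho> x = \<rho> (x \<otimes> s a) \<otimes>\<^bsub>M\<^esub> h a"
    using rho_right_ascent[of a "x \<otimes> s a"] assms x by simp
  then show ?thesis using assms by (simp add: M.m_assoc h_idem)
qed

text \<open>The exchange property where a descent first appears: \<open>a\<close> is an ascent of \<open>u\<close> and not of
  \<open>u s\<^sub>b\<close>. Evaluating \<open>h\<^sub>a \<rho>(u) h\<^sub>b\<close> from the left gives \<open>\<rho>(s\<^sub>a u)\<close>, because the following
  multiplication by \<open>s\<^sub>b\<close> shortens; evaluating it from the right gives \<open>\<rho>(u s\<^sub>b)\<close>.\<close>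
lemma exchange:
  assumes "a \<in> S" "b \<in> S" "u \<in> carrier W"
    and "ascent a u" "len u < len (u \<otimes> s b)" "\<not> ascent a (u \<otimes> s b)"
  shows "s a \<otimes> u = u \<otimes> s b"
proof -
  have "len (s a \<otimes> u \<otimes> s b) < len (s a \<otimes> u)"
    using len_s[of a "u \<otimes> s b"] len_s_right[of b u] assms
    by (auto simp: ascent_iff W.m_assoc)
  then have "\<rho> (s a \<otimes> u) = h a \<otimes>\<^bsub>M\<^esub> \<rho> u \<otimes>\<^bsub>M\<^esub> h b"
    using rho_right_descent[of b "s a \<otimes> u"] rho_ascent[of a u] assms by simp
  also have "\<dots> = h a \<otimes>\<^bsub>M\<^esub> \<rho> (u \<otimes> s b)"
    using rho_right_ascent[of b u] assms by (simp add: M.m_assoc)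
  also have "\<dots> = \<rho> (u \<otimes> s b)"
    using rho_descent[of a "u \<otimes> s b"] assms by simp
  finally show ?thesis using rho_inj assms by (auto dest: inj_onD)
qed

text \<open>If \<open>s\<^sub>a\<close> and \<open>s\<^sub>b\<close> are distinct and commute, then both \<open>ab\<close> and \<open>ba\<close> are reduced words for
  the same element.\<close>
lemma h_commute:
  assumes "a \<in> S" "b \<in> S" "s a \<otimes> s b = s b \<otimes> s a"
  shows "h a \<otimes>\<^bsub>M\<^esub> h b = h b \<otimes>\<^bsub>M\<^esub> h a"
proof -
  have one: "\<rho> (s c) = h c \<and> len (s c) = 1" if "c \<in> S" for c
    using rho_word[of "[c]"] even_len[of "[c]"] len_le[of "[c]"] that
    by (cases "len (s c)") auto
  show ?thesis
  proof (cases "s a = s b")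
    case True
    then show ?thesis using one assms by metis
  next
    case False
    \<comment> \<open>The length is even and at most two, so only length zero has to be excluded.\<close>
    have "s a \<otimes> s b \<noteq> \<one>"
      using False W.inv_equality[of "s a" "s b"] assms by auto
    then have "len (s a \<otimes> s b) = 2"
      using len_s[of a "s b"] one assms len_eq_0[of "s a \<otimes> s b"] by auto
    then have "ascent a (s b)" "ascent b (s a)"
      using one assms by (auto simp: ascent_def)
    then show ?thesis using rho_ascent[of a "s b"] rho_ascent[of b "s a"] one assms by simp
  qed
qed

text \<open>Otherwise \<open>h\<^sub>a h\<^sub>b \<rho>(x) = h\<^sub>b h\<^sub>a \<rho>(x)\<close> would be equal to both \<open>\<rho>(s\<^sub>b x)\<close> and \<open>\<rho>(s\<^sub>a x)\<close>,
  against injectivity.\<close>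
lemma ascent_commute:
  assumes "a \<in> S" "b \<in> S" "x \<in> carrier W" "s a \<otimes> s b = s b \<otimes> s a" "s a \<noteq> s b"
    and "ascent a x" "ascent b x"
  shows "ascent a (s b \<otimes> x)"
proof (rule ccontr)
  assume na: "\<not> ascent a (s b \<otimes> x)"
  have comm: "s a \<otimes> (s b \<otimes> x) = s b \<otimes> (s a \<otimes> x)"
    using assms by (simp add: W.m_assoc[symmetric])
  have "len (s b \<otimes> (s a \<otimes> x)) < len (s b \<otimes> x)" "len (s b \<otimes> x) = len (s a \<otimes> x)"
    using na len_s[of a "s b \<otimes> x"] assms comm by (auto simp: ascent_iff)
  then have nb: "\<not> ascent b (s a \<otimes> x)" by (simp add: ascent_def)
  have "\<rho> (s b \<otimes> x) = h a \<otimes>\<^bsub>M\<^esub> (h b \<otimes>\<^bsub>M\<^esub> \<rho> x)"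
    using rho_descent[OF _ _ na] rho_ascent[of b x] assms by simp
  also have "\<dots> = h b \<otimes>\<^bsub>M\<^esub> (h a \<otimes>\<^bsub>M\<^esub> \<rho> x)"
    using h_commute[of a b] assms by (simp add: M.m_assoc[symmetric])
  also have "\<dots> = \<rho> (s a \<otimes> x)"
    using rho_descent[OF _ _ nb] rho_ascent[of a x] assms by simp
  finally have "s b \<otimes> x = s a \<otimes> x"
    using rho_inj assms by (auto dest: inj_onD)
  then show False using assms by simp
qed

text \<open>Commuting generators that are all ascents of \<open>x\<close> can be multiplied on one after the other,
  each of them lengthening, since the remaining ones stay ascents.\<close>
lemma len_commuting_block:
  assumes A: "A \<subseteq> S" "inj_on s A" "\<And>a b. a \<in> A \<Longrightarrow> b \<in> A \<Longrightarrow> s a \<otimes> s b = s b \<otimes> s a"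
    and x: "x \<in> carrier W" "\<And>a. a \<in> A \<Longrightarrow> ascent a x"
    and as: "distinct as" "set as \<subseteq> A"
  shows "len (word_prod W s as \<otimes> x) = length as + len x"
    and "\<rho> (word_prod W s as \<otimes> x) = word_prod M h as \<otimes>\<^bsub>M\<^esub> \<rho> x"
    and "a \<in> A - set as \<Longrightarrow> ascent a (word_prod W s as \<otimes> x)"
proof -
  have "len (word_prod W s as \<otimes> x) = length as + len x \<and>
      \<rho> (word_prod W s as \<otimes> x) = word_prod M h as \<otimes>\<^bsub>M\<^esub> \<rho> x \<and>
      (\<forall>a\<in>A - set as. ascent a (word_prod W s as \<otimes> x))"
    using as
  proof (induction as)
    case Nil
    then show ?case using x by simp
  next
    case (Cons b as)
    let ?y = "word_prod W s as \<otimes> x"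
    have S: "b \<in> S" "as \<in> lists S" using Cons.prems A by auto
    then have y: "?y \<in> carrier W" using x by simp
    have eq: "word_prod W s (b # as) \<otimes> x = s b \<otimes> ?y"
      using S x by (simp add: W.m_assoc)
    have up: "ascent b ?y" using Cons by auto
    have "ascent a (s b \<otimes> ?y)" if a: "a \<in> A - set (b # as)" for a
    proof (rule ascent_commute)
      show "s a \<noteq> s b" using a A(2) Cons.prems by (auto dest: inj_onD)
      show "ascent a ?y" using a Cons by auto
    qed (use a A Cons.prems S y up in auto)
    then show ?case
      using Cons up S x y unfolding eq
      by (auto simp: ascent_iff rho_ascent M.m_assoc)
  qed
  then show "len (word_prod W s as \<otimes> x) = length as + len x"
    and "\<rho> (word_prod W s as \<otimes> x) = word_prod M h as \<otimes>\<^bsub>M\<^esub> \<rho> x"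
    and "a \<in> A - set as \<Longrightarrow> ascent a (word_prod W s as \<otimes> x)"
    by auto
qed

lemma rho_descent_block:
  assumes "x \<in> carrier W" "as \<in> lists S" "\<And>a. a \<in> set as \<Longrightarrow> \<not> ascent a x"
  shows "word_prod M h as \<otimes>\<^bsub>M\<^esub> \<rho> x = \<rho> x"
  using assms(2,3) by (induction as) (use assms(1) rho_descent in \<open>auto simp: M.m_assoc\<close>)

lemma wp_commute:
  assumes "as \<in> lists S" "b \<in> S" "\<And>a. a \<in> set as \<Longrightarrow> s a \<otimes> s b = s b \<otimes> s a"
  shows "word_prod W s as \<otimes> s b = s b \<otimes> word_prod W s as"
  using assms(1,3)
proof (induction as)
  case Nil
  then show ?case using assms(2) by simp
next
  case (Cons a as)
  then have "word_prod W s (a # as) \<otimes> s b = s a \<otimes> (s b \<otimes> word_prod W s as)"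
    using assms(2) by (simp add: W.m_assoc)
  also have "\<dots> = s b \<otimes> word_prod W s (a # as)"
    using Cons assms(2) by (simp add: W.m_assoc[symmetric])
  finally show ?case .
qed

text \<open>The exchange property for a block of commuting letters. The exchange takes place at some
  letter \<open>b\<close> of the block; the letters before it commute with \<open>s\<^sub>b\<close> and cancel, so that only \<open>u\<close>
  remains in the conclusion.\<close>
lemma exchange_block:
  assumes B: "B \<subseteq> S" "inj_on s B" "\<And>a b. a \<in> B \<Longrightarrow> b \<in> B \<Longrightarrow> s a \<otimes> s b = s b \<otimes> s a"
    and u: "u \<in> carrier W" "\<And>b. b \<in> B \<Longrightarrow> ascent b (inv u)"
    and a: "a \<in> S" "ascent a u"
    and bs: "distinct bs" "set bs \<subseteq> B" "\<not> ascent a (u \<otimes> word_prod W s bs)"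
  shows "\<exists>b\<in>B. s a \<otimes> u = u \<otimes> s b"
  using bs
proof (induction bs rule: rev_induct)
  case Nil
  then show ?case using a u by simp
next
  case (snoc b bs)
  let ?k = "word_prod W s bs"
  let ?y = "u \<otimes> ?k"
  have S: "b \<in> S" "bs \<in> lists S" using snoc.prems B by auto
  then have y: "?y \<in> carrier W" "?k \<in> carrier W" using u by auto
  show ?case
  proof (cases "ascent a ?y")
    case False
    then show ?thesis using snoc by auto
  next
    case True
    have eq: "u \<otimes> word_prod W s (bs @ [b]) = ?y \<otimes> s b"
      using S u by (simp add: wp_append W.m_assoc)
    have "ascent b (word_prod W s (rev bs) \<otimes> inv u)"
      using len_commuting_block(3)[OF B, of "inv u" "rev bs" b] u snoc.prems by auto
    then have "ascent b (inv ?y)" using S u by (simp add: wp_rev W.inv_mult_group)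
    then have "len ?y < len (?y \<otimes> s b)"
      using S y len_inv[of ?y] len_inv[of "?y \<otimes> s b"] by (simp add: ascent_def W.inv_mult_group[of ?y])
    then have "s a \<otimes> ?y = ?y \<otimes> s b"
      using exchange[of a b ?y] a S y True snoc.prems(3) eq by simp
    also have "\<dots> = u \<otimes> s b \<otimes> ?k"
    proof -
      have "s c \<otimes> s b = s b \<otimes> s c" if "c \<in> set bs" for c
        using B(3) snoc.prems that by auto
      then show ?thesis using wp_commute[of bs b] S u by (simp add: W.m_assoc)
    qed
    finally have "s a \<otimes> u \<otimes> ?k = u \<otimes> s b \<otimes> ?k" using a S u y by (simp add: W.m_assoc)
    then have "s a \<otimes> u = u \<otimes> s b" using a S u y by simp
    then show ?thesis using snoc.prems by auto
  qed
qed

lemma len_hom_le: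
  assumes "\<phi> \<in> hom W W" "\<pi> \<in> S \<rightarrow> S" "\<And>a. a \<in> S \<Longrightarrow> \<phi> (s a) = s (\<pi> a)" "x \<in> carrier W"
  shows "len (\<phi> x) \<le> len x"
proof -
  obtain as where as: "as \<in> lists S" "length as = len x" "word_prod W s as = x"
    using reduced_exists[OF assms(4)] by blast
  have "\<phi> (word_prod W s as) = word_prod W s (map \<pi> as)"
    using W.word_prod_hom[where f' = s and \<pi> = \<pi>, OF assms(1) _ s_Pi assms(3) as(1)] hom_one[OF assms(1) W.group_axioms W.group_axioms]
    by simp
  then have \<phi>: "\<phi> x = word_prod W s (map \<pi> as)" using as(3) by simp
  have "map \<pi> as \<in> lists S" using as(1) assms(2) by auto
  then have "len (\<phi> x) \<le> length (map \<pi> as)" unfolding \<phi> by (rule len_le)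
  then show ?thesis using as(2) by simp
qed

text \<open>A homomorphism that maps generators to generators and keeps the length of \<open>x\<close> maps a reduced word
  of \<open>x\<close> to a reduced word.\<close>
lemma rho_equivariant:
  assumes "\<phi> \<in> hom W W" "\<pi> \<in> S \<rightarrow> S" "\<And>a. a \<in> S \<Longrightarrow> \<phi> (s a) = s (\<pi> a)"
    and "\<chi> \<in> hom M M" "\<chi> \<one>\<^bsub>M\<^esub> = \<one>\<^bsub>M\<^esub>" "\<And>a. a \<in> S \<Longrightarrow> \<chi> (h a) = h (\<pi> a)"
    and "x \<in> carrier W" "len (\<phi> x) = len x"
  shows "\<rho> (\<phi> x) = \<chi> (\<rho> x)"
proof -
  obtain as where as: "as \<in> lists S" "length as = len x" "word_prod W s as = x"
    using reduced_exists[OF assms(7)] by blast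
  have "\<phi> (word_prod W s as) = word_prod W s (map \<pi> as)"
    using W.word_prod_hom[where f' = s and \<pi> = \<pi>, OF assms(1) _ s_Pi assms(3) as(1)] hom_one[OF assms(1) W.group_axioms W.group_axioms]
    by simp
  then have \<phi>: "\<phi> x = word_prod W s (map \<pi> as)" using as(3) by simp
  have \<chi>: "\<chi> (word_prod M h as) = word_prod M h (map \<pi> as)"
    using M.word_prod_hom[where f' = h and \<pi> = \<pi>, OF assms(4,5) h_Pi assms(6) as(1)] .
  have "map \<pi> as \<in> lists S" using as(1) assms(2) by auto
  then have "\<rho> (\<phi> x) = word_prod M h (map \<pi> as)"
    unfolding \<phi> using as(2) assms(8) \<phi> by (intro rho_word) simp_all
  moreover have "\<rho> x = word_prod M h as" using rho_word[OF as(1)] as(2,3) by simp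
  ultimately show ?thesis using \<chi> by simp
qed

end

section \<open>Folding\<close>

text \<open>The generators of the first system are indexed by blocks of generators of the second. A
  family of symmetries, transitive on each block, fixes the image of the embedding \<open>\<psi>\<close>, and \<open>\<psi>\<close>
  sends the generator of a block to the product of its elements in any order.\<close>
locale folding_system =
  C: tsaranov_system W M T r f \<rho>C + Q: tsaranov_system V N S s h \<rho>Q
  for W :: "('x, 'r) monoid_scheme" and M :: "('y, 't) monoid_scheme"
    and T :: "'a set set" and r :: "'a set \<Rightarrow> 'x" and f :: "'a set \<Rightarrow> 'y" and \<rho>C :: "'x \<Rightarrow> 'y"
    and V :: "('u, 'p) monoid_scheme" and N :: "('z, 'q) monoid_scheme"
    and S :: "'a set" and s :: "'a \<Rightarrow> 'u" and h :: "'a \<Rightarrow> 'z" and \<rho>Q :: "'u \<Rightarrow> 'z" +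
  fixes \<psi> :: "'x \<Rightarrow> 'u" and I :: "'g set" and \<alpha> :: "'g \<Rightarrow> 'a \<Rightarrow> 'a" and \<gamma> :: "'g \<Rightarrow> 'u \<Rightarrow> 'u"
  assumes block: "A \<in> T \<Longrightarrow> A \<subseteq> S" "A \<in> T \<Longrightarrow> finite A" "A \<in> T \<Longrightarrow> A \<noteq> {}"
    and s_inj: "inj_on s S"
    and act_S: "g \<in> I \<Longrightarrow> \<alpha> g \<in> S \<rightarrow> S"
    and act_block: "g \<in> I \<Longrightarrow> A \<in> T \<Longrightarrow> i \<in> A \<Longrightarrow> \<alpha> g i \<in> A"
    and transitive: "A \<in> T \<Longrightarrow> i \<in> A \<Longrightarrow> j \<in> A \<Longrightarrow> \<exists>g\<in>I. \<alpha> g i = j"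
    and sym_hom: "g \<in> I \<Longrightarrow> \<gamma> g \<in> hom V V"
    and sym_gen: "g \<in> I \<Longrightarrow> i \<in> S \<Longrightarrow> \<gamma> g (s i) = s (\<alpha> g i)"
    and psi_hom: "\<psi> \<in> hom W V"
    and psi_inj: "inj_on \<psi> (carrier W)"
    and psi_fixed: "g \<in> I \<Longrightarrow> w \<in> carrier W \<Longrightarrow> \<gamma> g (\<psi> w) = \<psi> w"
    and psi_gen: "A \<in> T \<Longrightarrow> distinct is \<Longrightarrow> set is = A \<Longrightarrow> \<psi> (r A) = word_prod V s is"
begin

lemma psi_closed [simp]: "w \<in> carrier W \<Longrightarrow> \<psi> w \<in> carrier V"
  using psi_hom by (auto simp: hom_def)

lemma psi_mult: "w \<in> carrier W \<Longrightarrow> w' \<in> carrier W \<Longrightarrow> \<psi> (w \<otimes>\<^bsub>W\<^esub> w') = \<psi> w \<otimes>\<^bsub>V\<^esub> \<psi> w'"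
  using psi_hom by (rule hom_mult)

lemma psi_one [simp]: "\<psi> \<one>\<^bsub>W\<^esub> = \<one>\<^bsub>V\<^esub>"
  using psi_hom C.W.group_axioms Q.W.group_axioms by (rule hom_one)

lemma psi_inv: "w \<in> carrier W \<Longrightarrow> \<psi> (inv\<^bsub>W\<^esub> w) = inv\<^bsub>V\<^esub> \<psi> w"
  using group_hom.hom_inv[of W V \<psi> w] psi_hom C.W.group_axioms Q.W.group_axioms
  by (simp add: group_hom_def group_hom_axioms_def)

lemma block_mem: "A \<in> T \<Longrightarrow> i \<in> A \<Longrightarrow> i \<in> S"
  using block(1) by blast

lemma block_inj: "A \<in> T \<Longrightarrow> inj_on s A"
  by (rule inj_on_subset[OF s_inj block(1)])

lemma block_list: "A \<in> T \<Longrightarrow> \<exists>is. distinct is \<and> set is = A"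
  using finite_distinct_list[OF block(2)] by blast

text \<open>Two enumerations of the block that differ by swapping the first two letters have the same
  product, and the rest cancels.\<close>
lemma block_commute:
  assumes "A \<in> T" "i \<in> A" "j \<in> A"
  shows "s i \<otimes>\<^bsub>V\<^esub> s j = s j \<otimes>\<^bsub>V\<^esub> s i"
proof (cases "i = j")
  case False
  obtain ks where ks: "distinct ks" "set ks = A - {i, j}"
    using finite_distinct_list[of "A - {i, j}"] block(2)[OF assms(1)] by auto
  have S: "i \<in> S" "j \<in> S" "ks \<in> lists S" using ks assms block(1)[OF assms(1)] by auto
  have enum: "set (i # j # ks) = A" "set (j # i # ks) = A" using ks(2) assms by auto
  have "word_prod V s (i # j # ks) = \<psi> (r A)" "word_prod V s (j # i # ks) = \<psi> (r A)"
    using psi_gen[OF assms(1) _ enum(1)] psi_gen[OF assms(1) _ enum(2)] ks False by simp_all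
  then have "s i \<otimes>\<^bsub>V\<^esub> s j \<otimes>\<^bsub>V\<^esub> word_prod V s ks = s j \<otimes>\<^bsub>V\<^esub> s i \<otimes>\<^bsub>V\<^esub> word_prod V s ks"
    using S by (simp add: Q.W.m_assoc)
  then show ?thesis using S by simp
qed simp

text \<open>A symmetry that takes \<open>j\<close> to \<open>i\<close> fixes \<open>\<psi>(w)\<close> and does not increase length.\<close>
lemma ascent_transfer:
  assumes "w \<in> carrier W" "A \<in> T" "i \<in> A" "j \<in> A" "Q.ascent i (\<psi> w)"
  shows "Q.ascent j (\<psi> w)"
proof -
  obtain g where g: "g \<in> I" "\<alpha> g j = i" using transitive[OF assms(2,4,3)] by blast
  have S: "i \<in> S" "j \<in> S" using block_mem[OF assms(2)] assms(3,4) by blast+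
  have "\<gamma> g (s j \<otimes>\<^bsub>V\<^esub> \<psi> w) = s i \<otimes>\<^bsub>V\<^esub> \<psi> w"
    using hom_mult[OF sym_hom[OF g(1)]] g assms S by (simp add: sym_gen psi_fixed)
  then have "Q.len (s i \<otimes>\<^bsub>V\<^esub> \<psi> w) \<le> Q.len (s j \<otimes>\<^bsub>V\<^esub> \<psi> w)"
    using Q.len_hom_le[OF sym_hom act_S sym_gen, of g "s j \<otimes>\<^bsub>V\<^esub> \<psi> w"] g S assms by simp
  then show ?thesis using assms(5) by (simp add: Q.ascent_def)
qed

text \<open>Conjugation by the invariant element \<open>\<psi>(w)\<close> commutes with the symmetries. If it takes one
  generator of the block \<open>B\<close> to one of the block \<open>A\<close>, it therefore matches the two blocks
  bijectively, and hence takes the product over \<open>B\<close> to the product over \<open>A\<close>.\<close>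
lemma conjugate_block:
  assumes "A \<in> T" "B \<in> T" "w \<in> carrier W" "i \<in> A" "j \<in> B"
    and eq: "s i \<otimes>\<^bsub>V\<^esub> \<psi> w = \<psi> w \<otimes>\<^bsub>V\<^esub> s j"
  shows "r A \<otimes>\<^bsub>W\<^esub> w = w \<otimes>\<^bsub>W\<^esub> r B"
proof -
  let ?v = "\<psi> w"
  have v: "?v \<in> carrier V" using assms by simp
  have S: "i' \<in> S" "j' \<in> S" if "i' \<in> A" "j' \<in> B" for i' j'
    using that block_mem[OF assms(1)] block_mem[OF assms(2)] by blast+
  have ij: "i \<in> S" "j \<in> S" using S assms by blast+
  have moved: "s (\<alpha> g i) \<otimes>\<^bsub>V\<^esub> ?v = ?v \<otimes>\<^bsub>V\<^esub> s (\<alpha> g j)" if g: "g \<in> I" for g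
  proof -
    have "\<gamma> g (s i \<otimes>\<^bsub>V\<^esub> ?v) = \<gamma> g (?v \<otimes>\<^bsub>V\<^esub> s j)" using eq by simp
    then show ?thesis
      using hom_mult[OF sym_hom[OF g]] g assms(3) v ij by (simp add: sym_gen psi_fixed)
  qed
  have "\<exists>j'\<in>B. s i' \<otimes>\<^bsub>V\<^esub> ?v = ?v \<otimes>\<^bsub>V\<^esub> s j'" if "i' \<in> A" for i'
    using transitive[OF assms(1,4) that] moved act_block[OF _ assms(2,5)] by metis
  then obtain \<tau> where \<tau>: "\<And>i'. i' \<in> A \<Longrightarrow> \<tau> i' \<in> B \<and> s i' \<otimes>\<^bsub>V\<^esub> ?v = ?v \<otimes>\<^bsub>V\<^esub> s (\<tau> i')"
    by metis
  have inj: "inj_on \<tau> A"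
  proof
    fix k l assume kl: "k \<in> A" "l \<in> A" "\<tau> k = \<tau> l"
    then have "s k \<otimes>\<^bsub>V\<^esub> ?v = s l \<otimes>\<^bsub>V\<^esub> ?v" using \<tau> by metis
    then show "k = l" using kl v S assms(5) inj_onD[OF s_inj] by simp
  qed
  have surj: "\<tau> ` A = B"
  proof
    show "\<tau> ` A \<subseteq> B" using \<tau> by auto
    show "B \<subseteq> \<tau> ` A"
    proof
      fix j' assume j': "j' \<in> B"
      then obtain g where g: "g \<in> I" "\<alpha> g j = j'" using transitive[OF assms(2,5)] by blast
      let ?i = "\<alpha> g i"
      have i: "?i \<in> A" by (rule act_block[OF g(1) assms(1,4)])
      have "?v \<otimes>\<^bsub>V\<^esub> s (\<tau> ?i) = ?v \<otimes>\<^bsub>V\<^esub> s j'" using \<tau>[OF i] moved[OF g(1)] g(2) by simp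
      moreover have "\<tau> ?i \<in> S" "j' \<in> S" using \<tau>[OF i] i j' S by blast+
      ultimately have "\<tau> ?i = j'" using v inj_onD[OF s_inj] by simp
      then show "j' \<in> \<tau> ` A" using i by blast
    qed
  qed
  obtain "is" where enum: "distinct is" "set is = A" using block_list[OF assms(1)] by blast
  have pass: "word_prod V s ks \<otimes>\<^bsub>V\<^esub> ?v = ?v \<otimes>\<^bsub>V\<^esub> word_prod V s (map \<tau> ks)" if "set ks \<subseteq> A" for ks
    using that
  proof (induction ks)
    case Nil
    then show ?case using v by simp
  next
    case (Cons k ks)
    have mem: "c \<in> S \<and> \<tau> c \<in> S" if "c \<in> set (k # ks)" for c
      using that Cons.prems \<tau>[of c] S by blast
    then have S: "k \<in> S" "\<tau> k \<in> S" "ks \<in> lists S" "map \<tau> ks \<in> lists S" by auto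
    have "word_prod V s (k # ks) \<otimes>\<^bsub>V\<^esub> ?v = s k \<otimes>\<^bsub>V\<^esub> ?v \<otimes>\<^bsub>V\<^esub> word_prod V s (map \<tau> ks)"
      using Cons S v by (simp add: Q.W.m_assoc)
    also have "\<dots> = ?v \<otimes>\<^bsub>V\<^esub> word_prod V s (map \<tau> (k # ks))"
      using \<tau>[of k] Cons.prems S v by (simp add: Q.W.m_assoc)
    finally show ?case .
  qed
  have "\<psi> (r A) = word_prod V s is" by (rule psi_gen[OF assms(1) enum])
  moreover have "\<psi> (r B) = word_prod V s (map \<tau> is)"
    using psi_gen[OF assms(2), of "map \<tau> is"] enum inj surj by (simp add: distinct_map)
  ultimately have "\<psi> (r A \<otimes>\<^bsub>W\<^esub> w) = \<psi> (w \<otimes>\<^bsub>W\<^esub> r B)"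
    using pass[of "is"] enum assms by (simp add: psi_mult)
  then show ?thesis using psi_inj assms by (auto dest: inj_onD)
qed

text \<open>Induction on the length of \<open>w\<close>, splitting off the last letter of a reduced word,
  \<open>w = w' r\<^sub>B\<close>. The hypothesis is used twice: for \<open>A\<close> and \<open>w'\<close>, and for \<open>B\<close> and \<open>w'\<inverse>\<close>, which says that
  the letters of \<open>B\<close> lengthen \<open>\<psi>(w')\<close> from the right. If the claim failed for \<open>w\<close>, an exchange
  inside \<open>B\<close> would give \<open>r\<^sub>A w' = w' r\<^sub>B\<close>, and \<open>A\<close> would be a descent of \<open>w\<close>.\<close>
lemma ascent_block:
  assumes "w \<in> carrier W" "A \<in> T" "C.ascent A w" "i \<in> A"
  shows "Q.ascent i (\<psi> w)"
  using assms
proof (induction "C.len w" arbitrary: w A i rule: less_induct)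
  case less
  note [simp] = \<open>w \<in> carrier W\<close> \<open>A \<in> T\<close>
  have i: "i \<in> S" by (rule block_mem[OF less.prems(2,4)])
  obtain As where As: "As \<in> lists T" "length As = C.len w" "word_prod W r As = w"
    using C.reduced_exists[OF less.prems(1)] by blast
  show ?case
  proof (cases As rule: rev_cases)
    case Nil
    then have "w = \<one>\<^bsub>W\<^esub>" using As by simp
    then show ?thesis using Q.len_s[OF i, of "\<one>\<^bsub>V\<^esub>"] by (auto simp: Q.ascent_def)
  next
    case (snoc Bs B)
    define w' where "w' = word_prod W r Bs"
    have B [simp]: "B \<in> T" and Bs: "Bs \<in> lists T" using As snoc by auto
    have w' [simp]: "w' \<in> carrier W" using Bs by (simp add: w'_def)
    have w: "w = w' \<otimes>\<^bsub>W\<^esub> r B" using As snoc Bs by (simp add: w'_def C.wp_append)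
    have lw: "C.len w = Suc (C.len w')"
      using C.len_s_right[OF B w'] C.len_le[OF Bs] As snoc w by (auto simp: w'_def)
    have "C.len (r A \<otimes>\<^bsub>W\<^esub> w) \<le> Suc (C.len (r A \<otimes>\<^bsub>W\<^esub> w'))"
      using C.len_s_right[OF B, of "r A \<otimes>\<^bsub>W\<^esub> w'"] w by (auto simp: C.W.m_assoc)
    then have up: "C.ascent A w'"
      using less.prems(3) lw by (simp add: C.ascent_def)
    have "C.len (r B \<otimes>\<^bsub>W\<^esub> inv\<^bsub>W\<^esub> w') = C.len w"
      using C.len_inv[of w] w by (simp add: C.W.inv_mult_group)
    then have up': "C.ascent B (inv\<^bsub>W\<^esub> w')" using lw by (simp add: C.ascent_def C.len_inv[OF w'])
    have upQ: "Q.ascent i (\<psi> w')" using less.hyps[of w' A i] lw up less.prems by simp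
    have upQ': "Q.ascent j (inv\<^bsub>V\<^esub> \<psi> w')" if "j \<in> B" for j
      using less.hyps[of "inv\<^bsub>W\<^esub> w'" B j] lw up' that by (simp add: psi_inv C.len_inv[OF w'])
    obtain js where js: "distinct js" "set js = B" using block_list[OF B] by blast
    have v: "\<psi> w = \<psi> w' \<otimes>\<^bsub>V\<^esub> word_prod V s js"
      using psi_gen[OF B js] w by (simp add: psi_mult)
    show ?thesis
    proof (rule ccontr)
      assume "\<not> Q.ascent i (\<psi> w)"
      then obtain j where j: "j \<in> B" "s i \<otimes>\<^bsub>V\<^esub> \<psi> w' = \<psi> w' \<otimes>\<^bsub>V\<^esub> s j"
        using Q.exchange_block[OF block(1)[OF B] block_inj[OF B] block_commute[OF B], of "\<psi> w'" i js]
          upQ upQ' i js v by auto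
      have "r A \<otimes>\<^bsub>W\<^esub> w' = w"
        using conjugate_block[of A B w' i j] j less.prems w by simp
      then have "r A \<otimes>\<^bsub>W\<^esub> w = w'" using C.s_cancel[of A w'] by simp
      then show False using less.prems(3) lw by (simp add: C.ascent_def)
    qed
  qed
qed

text \<open>The graph of the correspondence between \<open>\<rho>C(w)\<close> and \<open>\<rho>Q(\<psi>(w))\<close> is stable under multiplication
  by \<open>f\<^sub>A\<close> on one side and by the product of the \<open>h\<^sub>i\<close> over \<open>A\<close> on the other. If \<open>A\<close> is a descent of
  \<open>w\<close>, it is an ascent of \<open>r\<^sub>A w\<close>, so \<open>\<psi>(w)\<close> is longer than \<open>\<psi>(r\<^sub>A w)\<close>; an ascent of \<open>\<psi>(w)\<close> in \<open>A\<close>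
  would, by symmetry, make all of \<open>A\<close> ascents and give the opposite inequality.\<close>
lemma fold_step:
  assumes "w \<in> carrier W" "A \<in> T" "distinct is" "set is = A"
  shows "\<exists>w'\<in>carrier W. \<rho>C w' = f A \<otimes>\<^bsub>M\<^esub> \<rho>C w \<and>
    \<rho>Q (\<psi> w') = word_prod N h is \<otimes>\<^bsub>N\<^esub> \<rho>Q (\<psi> w)"
proof -
  note [simp] = assms(1,2)
  have A: "A \<subseteq> S" "inj_on s A" using block(1) block_inj assms(2) by blast+
  have psi_A: "\<psi> (r A \<otimes>\<^bsub>W\<^esub> x) = word_prod V s is \<otimes>\<^bsub>V\<^esub> \<psi> x" if "x \<in> carrier W" for x
    using psi_gen[OF assms(2-4)] that by (simp add: psi_mult)
  note up_block = Q.len_commuting_block[OF A block_commute[OF assms(2)] psi_closed _ assms(3)]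
  show ?thesis
  proof (cases "C.ascent A w")
    case True
    then have "\<rho>Q (\<psi> (r A \<otimes>\<^bsub>W\<^esub> w)) = word_prod N h is \<otimes>\<^bsub>N\<^esub> \<rho>Q (\<psi> w)"
      using up_block(2)[of w] ascent_block[of w A] psi_A assms(4) by simp
    then show ?thesis using True
      by (intro bexI[of _ "r A \<otimes>\<^bsub>W\<^esub> w"]) (simp_all add: C.rho_ascent)
  next
    case False
    define w1 where "w1 = r A \<otimes>\<^bsub>W\<^esub> w"
    have w1: "w1 \<in> carrier W" "C.ascent A w1" "w = r A \<otimes>\<^bsub>W\<^esub> w1"
      using False C.ascent_s[of A w] by (simp_all add: w1_def)
    have l: "Q.len (\<psi> w) = length is + Q.len (\<psi> w1)"
      using up_block(1)[of w1] ascent_block[OF w1(1) _ w1(2)] psi_A[OF w1(1)] w1 assms(4) by simp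
    have "\<not> Q.ascent i (\<psi> w)" if i: "i \<in> A" for i
    proof
      assume "Q.ascent i (\<psi> w)"
      then have "Q.len (\<psi> w1) = length is + Q.len (\<psi> w)"
        using up_block(1)[of w] ascent_transfer[OF assms(1,2) i] psi_A[OF assms(1)] assms(4)
        by (simp add: w1_def)
      then have "is = []" using l by simp
      then show False using i assms(4) by simp
    qed
    then have "word_prod N h is \<otimes>\<^bsub>N\<^esub> \<rho>Q (\<psi> w) = \<rho>Q (\<psi> w)"
      using A(1) assms(4) by (intro Q.rho_descent_block) auto
    then show ?thesis using False C.rho_descent[of A w] by (intro bexI[of _ w]) simp_all
  qed
qed

text \<open>Iterating \<open>fold_step\<close> along a reduced word of \<open>w1\<close> multiplies \<open>\<rho>Q(\<psi>(w2))\<close> by a product that depends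
  on the word alone; the case \<open>w2 = 1\<close> identifies this product as \<open>\<rho>Q(\<psi>(w1))\<close>.\<close>
theorem fold_mult:
  assumes "w1 \<in> carrier W" "w2 \<in> carrier W"
  shows "\<exists>w\<in>carrier W. \<rho>C w = \<rho>C w1 \<otimes>\<^bsub>M\<^esub> \<rho>C w2 \<and>
    \<rho>Q (\<psi> w) = \<rho>Q (\<psi> w1) \<otimes>\<^bsub>N\<^esub> \<rho>Q (\<psi> w2)"
proof -
  obtain en where en: "\<And>A. A \<in> T \<Longrightarrow> distinct (en A) \<and> set (en A) = A"
    using block_list by metis
  define H where "H A = word_prod N h (en A)" for A
  have H: "H \<in> T \<rightarrow> carrier N"
  proof
    fix A assume A: "A \<in> T"
    then have "en A \<in> lists S" using en[OF A] block_mem[OF A] by simp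
    then show "H A \<in> carrier N" unfolding H_def by (rule Q.hp_closed)
  qed
  have word: "\<exists>w'\<in>carrier W. \<rho>C w' = word_prod M f As \<otimes>\<^bsub>M\<^esub> \<rho>C w \<and>
      \<rho>Q (\<psi> w') = word_prod N H As \<otimes>\<^bsub>N\<^esub> \<rho>Q (\<psi> w)"
    if "As \<in> lists T" "w \<in> carrier W" for As w
    using that(1)
  proof (induction As)
    case Nil
    then show ?case using that(2) by (intro bexI[of _ w]) auto
  next
    case (Cons A As)
    then obtain w' where w': "w' \<in> carrier W" "\<rho>C w' = word_prod M f As \<otimes>\<^bsub>M\<^esub> \<rho>C w"
        "\<rho>Q (\<psi> w') = word_prod N H As \<otimes>\<^bsub>N\<^esub> \<rho>Q (\<psi> w)" by auto
    have mem: "A \<in> T" "As \<in> lists T" using Cons by auto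
    show ?case
      using fold_step[OF w'(1) mem(1), of "en A", folded H_def] en[OF mem(1)] w' mem that(2)
        Q.M.word_prod_closed[OF H mem(2)] H
      by (auto simp: C.M.m_assoc Q.M.m_assoc Pi_iff)
  qed
  obtain As where As: "As \<in> lists T" "length As = C.len w1" "word_prod W r As = w1"
    using C.reduced_exists[OF assms(1)] by blast
  have f: "\<rho>C w1 = word_prod M f As" using C.rho_word[of As] As by simp
  obtain w where w: "w \<in> carrier W" "\<rho>C w = word_prod M f As \<otimes>\<^bsub>M\<^esub> \<rho>C \<one>\<^bsub>W\<^esub>"
      "\<rho>Q (\<psi> w) = word_prod N H As \<otimes>\<^bsub>N\<^esub> \<rho>Q (\<psi> \<one>\<^bsub>W\<^esub>)"
    using word[OF As(1), of "\<one>\<^bsub>W\<^esub>"] by auto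
  have "\<rho>C w = \<rho>C w1" using w(2) f As(1) by simp
  then have "w = w1" using C.rho_inj w(1) assms(1) by (auto dest: inj_onD)
  then have "\<rho>Q (\<psi> w1) = word_prod N H As"
    using w(3) Q.M.word_prod_closed[OF H As(1)] by simp
  then show ?thesis using word[OF As(1) assms(2)] f by simp
qed

end

section \<open>Weyl groups and Weyl monoids as classes of words\<close>

lemma pres_class_eq_iff:
  "u \<in> lists S \<Longrightarrow> pres_class S R u = pres_class S R v \<longleftrightarrow> pres_eq S R u v"
  unfolding pres_class_def by (blast intro: pres_eq.refl pres_eq.sym pres_eq.trans)

lemma word_prod_presented:
  "map e as \<in> lists S \<Longrightarrow>
     word_prod (presented_monoid S R) (\<lambda>a. pres_class S R [e a]) as = pres_class S R (map e as)"
proof (induction as)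
  case Nil
  then show ?case by (simp add: presented_monoid_def)
next
  case (Cons a as)
  then show ?case using presented_monoid_mult[of "[e a]" S "map e as" R] by simp
qed

lemma word_prod_weyl_group:
  assumes "as \<in> lists S"
  shows "word_prod (weyl_group S m) (weyl_gen S m) as =
    pres_class (S \<times> UNIV) (group_rels (weyl_group_rels S m)) (map (\<lambda>a. (a, True)) as)"
  using assms
    word_prod_presented[of "\<lambda>a. (a, True)" as "S \<times> UNIV" "group_rels (weyl_group_rels S m)"]
  by (auto simp: weyl_group_def presented_group_def weyl_gen_def[abs_def])

lemma word_prod_weyl_monoid:
  "as \<in> lists S \<Longrightarrow>
     word_prod (weyl_monoid S m) (weyl_monoid_gen S m) as = pres_class S (weyl_monoid_rels S m) as"
  using word_prod_presented[of "\<lambda>a. a" as S "weyl_monoid_rels S m"]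
  by (simp add: weyl_monoid_def weyl_monoid_gen_def[abs_def])

lemma pres_eq_invariant:
  assumes "pres_eq S R u v"
    and "\<And>u v. (u, v) \<in> R \<Longrightarrow> F u = F v"
    and "\<And>p u u' q. F u = F u' \<Longrightarrow> F (p @ u @ q) = F (p @ u' @ q)"
  shows "F u = F v"
  using assms(1)
proof (induction rule: pres_eq.induct)
  case (rel u v p q)
  show ?case by (rule assms(3)[OF assms(2)[OF rel(1)]])
qed simp_all

lemma weyl_group_rels_even: "(u, v) \<in> group_rels (weyl_group_rels S m) \<Longrightarrow> even (length u) = even (length v)"
  by (auto simp: group_rels_def weyl_group_rels_def length_concat sum_list_replicate)

text \<open>Every generator is its own inverse, so inverse letters can be replaced by the letters
  themselves, and the generators of a Weyl group generate it as a monoid.\<close>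
lemma pres_eq_positive:
  assumes "u \<in> lists (S \<times> UNIV)"
  shows "pres_eq (S \<times> UNIV) (group_rels (weyl_group_rels S m)) u (map (\<lambda>x. (fst x, True)) u)"
  using assms
proof (induction u)
  case Nil
  then show ?case by (auto intro: pres_eq.refl)
next
  case (Cons x u)
  let ?S = "S \<times> (UNIV :: bool set)"
  let ?R = "group_rels (weyl_group_rels S m)"
  obtain a b where x: "x = (a, b)" by (cases x)
  have a: "a \<in> S" and u: "u \<in> lists ?S" using Cons.hyps x by auto
  have letter: "pres_eq ?S ?R [(a, b)] [(a, True)]"
  proof (cases b)
    case True
    then show ?thesis using a by (auto intro: pres_eq.refl)
  next
    case False
    have "pres_eq ?S ?R ([(a, False)] @ [(a, True), (a, True)] @ []) ([(a, False)] @ [] @ [])"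
      using a by (intro pres_eq.rel) (auto simp: group_rels_def weyl_group_rels_def)
    moreover have "pres_eq ?S ?R ([] @ [(a, False), (a, True)] @ [(a, True)]) ([] @ [] @ [(a, True)])"
      using a by (intro pres_eq.rel) (auto simp: group_rels_def)
    ultimately show ?thesis using False by (auto intro: pres_eq.sym pres_eq.trans)
  qed
  have "pres_eq ?S ?R ([] @ [(a, b)] @ u) ([] @ [(a, True)] @ u)"
    using u by (intro pres_eq_append[OF letter]) auto
  moreover have "pres_eq ?S ?R ([(a, True)] @ u @ []) ([(a, True)] @ map (\<lambda>x. (fst x, True)) u @ [])"
    using a u by (intro pres_eq_append[OF Cons.IH]) auto
  ultimately show ?case using x by (auto intro: pres_eq.trans)
qed

lemma tsaranov_system_weyl:
  assumes "tsaranov_bijection S m \<rho>"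
  shows "tsaranov_system (weyl_group S m) (weyl_monoid S m) S (weyl_gen S m) (weyl_monoid_gen S m) \<rho>"
proof -
  let ?S = "S \<times> (UNIV :: bool set)"
  let ?R = "group_rels (weyl_group_rels S m)"
  let ?pos = "map (\<lambda>a. (a, True))"
  interpret W: group "weyl_group S m"
    unfolding weyl_group_def by (rule group_presented_group)
  interpret M: monoid "weyl_monoid S m"
    unfolding weyl_monoid_def by (rule monoid_presented_monoid)
  have pos: "?pos as \<in> lists ?S" if "as \<in> lists S" for as :: "'a list"
    using that by auto
  have two: "weyl_gen S m a \<otimes>\<^bsub>weyl_group S m\<^esub> weyl_gen S m a = pres_class ?S ?R [(a, True), (a, True)]"
    if "a \<in> S" for a
    using presented_monoid_mult[of "[(a, True)]" ?S "[(a, True)]" ?R] that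
    by (simp add: weyl_group_def presented_group_def weyl_gen_def)
  have two_h: "weyl_monoid_gen S m a \<otimes>\<^bsub>weyl_monoid S m\<^esub> weyl_monoid_gen S m a =
      pres_class S (weyl_monoid_rels S m) [a, a]" if "a \<in> S" for a
    using presented_monoid_mult[of "[a]" S "[a]" "weyl_monoid_rels S m"] that
    by (simp add: weyl_monoid_def weyl_monoid_gen_def)
  show ?thesis
  proof
    show "weyl_gen S m \<in> S \<rightarrow> carrier (weyl_group S m)"
      by (auto simp: weyl_gen_def weyl_group_def presented_group_def presented_monoid_def)
    show "weyl_monoid_gen S m \<in> S \<rightarrow> carrier (weyl_monoid S m)"
      by (auto simp: weyl_monoid_gen_def weyl_monoid_def presented_monoid_def)
    show "\<exists>as\<in>lists S. word_prod (weyl_group S m) (weyl_gen S m) as = x"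
      if x: "x \<in> carrier (weyl_group S m)" for x
    proof -
      obtain u where u: "u \<in> lists ?S" "x = pres_class ?S ?R u"
        using x by (auto simp: weyl_group_def presented_group_def presented_monoid_def)
      have "map fst u \<in> lists S" using u(1) by auto
      moreover have "x = pres_class ?S ?R (?pos (map fst u))"
        using pres_eq_positive[OF u(1), of m] pres_class_eq_iff[OF u(1)] u(2)
        by (simp add: comp_def)
      ultimately show ?thesis using word_prod_weyl_group[of "map fst u" S m] by blast
    qed
    show "weyl_gen S m a \<otimes>\<^bsub>weyl_group S m\<^esub> weyl_gen S m a = \<one>\<^bsub>weyl_group S m\<^esub>" if "a \<in> S" for a
    proof -
      have "pres_eq ?S ?R ([] @ [(a, True), (a, True)] @ []) ([] @ [] @ [])"
        using that by (intro pres_eq.rel) (auto simp: group_rels_def weyl_group_rels_def)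
      then have "pres_class ?S ?R [(a, True), (a, True)] = pres_class ?S ?R []"
        using that by (subst pres_class_eq_iff) auto
      then show ?thesis
        using two[OF that] by (simp add: weyl_group_def presented_group_def presented_monoid_def)
    qed
    show "weyl_monoid_gen S m a \<otimes>\<^bsub>weyl_monoid S m\<^esub> weyl_monoid_gen S m a = weyl_monoid_gen S m a"
      if "a \<in> S" for a
    proof -
      have "pres_eq S (weyl_monoid_rels S m) ([] @ [a, a] @ []) ([] @ [a] @ [])"
        using that by (intro pres_eq.rel) (auto simp: weyl_monoid_rels_def)
      then have "pres_class S (weyl_monoid_rels S m) [a, a] = pres_class S (weyl_monoid_rels S m) [a]"
        using that by (subst pres_class_eq_iff) auto
      then show ?thesis using two_h[OF that] by (simp add: weyl_monoid_gen_def)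
    qed
    show "even (length as) = even (length bs)"
      if "as \<in> lists S" "bs \<in> lists S"
        "word_prod (weyl_group S m) (weyl_gen S m) as = word_prod (weyl_group S m) (weyl_gen S m) bs"
      for as bs
    proof -
      have "pres_eq ?S ?R (?pos as) (?pos bs)"
        using that word_prod_weyl_group[of as S m] word_prod_weyl_group[of bs S m]
          pres_class_eq_iff[OF pos[OF that(1)]] by simp
      then have "even (length (?pos as)) = even (length (?pos bs))"
        by (rule pres_eq_invariant) (use weyl_group_rels_even in auto)
      then show ?thesis by simp
    qed
    show "inj_on \<rho> (carrier (weyl_group S m))"
      using assms by (simp add: tsaranov_bijection_def bij_betw_def)
    show "\<rho> (word_prod (weyl_group S m) (weyl_gen S m) as) =
        word_prod (weyl_monoid S m) (weyl_monoid_gen S m) as"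
      if "as \<in> lists S" "\<forall>bs\<in>lists S. word_prod (weyl_group S m) (weyl_gen S m) bs =
        word_prod (weyl_group S m) (weyl_gen S m) as \<longrightarrow> length as \<le> length bs" for as
      using assms that by (simp add: tsaranov_bijection_def reduced_word_def)
  qed
qed

lemma set_alt_word: "set (alt_word n a b) = (if n = 0 then {} else if n = 1 then {a} else {a, b})"
  by (induction n arbitrary: a b) auto

text \<open>Apply \<open>\<rho>\<close> to pass to the monoid: there the set of letters of a word is an invariant, since
  the two sides of a braid relation have the same letters unless their length is one.\<close>
lemma weyl_gen_inj:
  assumes "tsaranov_bijection S m \<rho>" "\<And>a b. m a b \<noteq> 1"
  shows "inj_on (weyl_gen S m) S"
proof
  fix a b assume ab: "a \<in> S" "b \<in> S" "weyl_gen S m a = weyl_gen S m b"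
  interpret tsaranov_system "weyl_group S m" "weyl_monoid S m" S "weyl_gen S m" "weyl_monoid_gen S m" \<rho>
    by (rule tsaranov_system_weyl[OF assms(1)])
  have "\<rho> (weyl_gen S m c) = pres_class S (weyl_monoid_rels S m) [c]" if "c \<in> S" for c
    using rho_ascent[of c "\<one>\<^bsub>weyl_group S m\<^esub>"] len_s[of c "\<one>\<^bsub>weyl_group S m\<^esub>"] that
    by (auto simp: ascent_def weyl_monoid_gen_def[symmetric])
  then have "pres_class S (weyl_monoid_rels S m) [a] = pres_class S (weyl_monoid_rels S m) [b]"
    using ab by metis
  then have "pres_eq S (weyl_monoid_rels S m) [a] [b]"
    using ab(1) by (subst (asm) pres_class_eq_iff) auto
  then have "set [a] = set [b]"
  proof (rule pres_eq_invariant)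
    fix u v assume "(u, v) \<in> weyl_monoid_rels S m"
    then consider c where "u = [c, c]" "v = [c]"
      | c d where "u = alt_word (m c d) c d" "v = alt_word (m c d) d c"
      by (auto simp: weyl_monoid_rels_def)
    then show "set u = set v"
      by cases (use assms(2) in \<open>auto simp: set_alt_word\<close>)
  qed auto
  then show "a = b" by simp
qed

section \<open>Symmetries of presentations\<close>

text \<open>A permutation of the generators is given together with its inverse, because both must respect
  the relations for the letterwise image of a class to be a whole class.\<close>
locale presentation_symmetry =
  fixes S :: "'a set" and R :: "('a list \<times> 'a list) set" and \<pi> \<pi>' :: "'a \<Rightarrow> 'a"
  assumes into: "x \<in> S \<Longrightarrow> \<pi> x \<in> S" "x \<in> S \<Longrightarrow> \<pi>' x \<in> S"
    and inverse: "x \<in> S \<Longrightarrow> \<pi>' (\<pi> x) = x" "x \<in> S \<Longrightarrow> \<pi> (\<pi>' x) = x"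
    and rels: "(u, v) \<in> R \<Longrightarrow> u \<in> lists S \<Longrightarrow> v \<in> lists S \<Longrightarrow> (map \<pi> u, map \<pi> v) \<in> R"
      "(u, v) \<in> R \<Longrightarrow> u \<in> lists S \<Longrightarrow> v \<in> lists S \<Longrightarrow> (map \<pi>' u, map \<pi>' v) \<in> R"
begin

lemma converse: "presentation_symmetry S R \<pi>' \<pi>"
  by unfold_locales (use into inverse rels in auto)

lemma pres_eq_map: "pres_eq S R u v \<Longrightarrow> pres_eq S R (map \<pi> u) (map \<pi> v)"
proof (induction rule: pres_eq.induct)
  case (rel u v p q)
  then have "pres_eq S R (map \<pi> p @ map \<pi> u @ map \<pi> q) (map \<pi> p @ map \<pi> v @ map \<pi> q)"
    using into rels(1) by (intro pres_eq.rel) auto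
  then show ?case by simp
next
  case (refl u)
  then show ?case using into by (intro pres_eq.refl) auto
qed (blast intro: pres_eq.sym pres_eq.trans)+

lemma map_inverse: "u \<in> lists S \<Longrightarrow> map \<pi> (map \<pi>' u) = u" "u \<in> lists S \<Longrightarrow> map \<pi>' (map \<pi> u) = u"
  by (induction u) (auto simp: inverse)

lemma image_class:
  assumes "u \<in> lists S"
  shows "map \<pi> ` pres_class S R u = pres_class S R (map \<pi> u)"
proof
  show "map \<pi> ` pres_class S R u \<subseteq> pres_class S R (map \<pi> u)"
    by (auto simp: pres_class_def pres_eq_map)
  show "pres_class S R (map \<pi> u) \<subseteq> map \<pi> ` pres_class S R u"
  proof
    fix v assume "v \<in> pres_class S R (map \<pi> u)"
    then have v: "pres_eq S R (map \<pi> u) v" by (simp add: pres_class_def)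
    then have "pres_eq S R (map \<pi>' (map \<pi> u)) (map \<pi>' v)"
      by (rule presentation_symmetry.pres_eq_map[OF converse])
    then have "map \<pi>' v \<in> pres_class S R u"
      unfolding map_inverse(2)[OF assms] by (simp add: pres_class_def)
    moreover have "map \<pi> (map \<pi>' v) = v" using pres_eq_lists[OF v] by (intro map_inverse) auto
    ultimately show "v \<in> map \<pi> ` pres_class S R u" by (metis imageI)
  qed
qed

lemma image_hom: "(\<lambda>X. map \<pi> ` X) \<in> hom (presented_monoid S R) (presented_monoid S R)"
proof (rule homI)
  have c: "x \<in> carrier (presented_monoid S R) \<longleftrightarrow> (\<exists>u\<in>lists S. x = pres_class S R u)" for x
    by (auto simp: presented_monoid_def)
  have l: "map \<pi> u \<in> lists S" if "u \<in> lists S" for u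
    using that into by auto
  fix X assume "X \<in> carrier (presented_monoid S R)"
  then obtain u where u: "u \<in> lists S" "X = pres_class S R u" by (auto simp only: c)
  then show "map \<pi> ` X \<in> carrier (presented_monoid S R)"
    using image_class l c by metis
  fix Y assume "Y \<in> carrier (presented_monoid S R)"
  then obtain v where v: "v \<in> lists S" "Y = pres_class S R v" by (auto simp only: c)
  have "u @ v \<in> lists S" using u v by auto
  from image_class[OF this] show "map \<pi> ` (X \<otimes>\<^bsub>presented_monoid S R\<^esub> Y) =
      map \<pi> ` X \<otimes>\<^bsub>presented_monoid S R\<^esub> map \<pi> ` Y"
    using u v presented_monoid_mult[OF u(1) v(1), of R] presented_monoid_mult[OF l[OF u(1)] l[OF v(1)], of R]
    by (simp add: image_class)
qed

lemma image_one: "map \<pi> ` \<one>\<^bsub>presented_monoid S R\<^esub> = \<one>\<^bsub>presented_monoid S R\<^esub>"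
  using image_class[of "[]"] by (simp add: presented_monoid_def)

lemma image_inverse:
  assumes "X \<in> carrier (presented_monoid S R)"
  shows "map \<pi>' ` (map \<pi> ` X) = X"
proof -
  have "w \<in> lists S" if "w \<in> X" for w
    using that assms pres_eq_lists by (fastforce simp: presented_monoid_def pres_class_def)
  then show ?thesis using map_inverse(2) by (force simp: image_image)
qed

end

lemma map_alt_word: "map \<pi> (alt_word n a b) = alt_word n (\<pi> a) (\<pi> b)"
  by (induction n arbitrary: a b) auto

lemma weyl_presentation_symmetry:
  assumes into: "\<And>x. x \<in> S \<Longrightarrow> \<pi> x \<in> S" "\<And>x. x \<in> S \<Longrightarrow> \<pi>' x \<in> S"
    and inverse: "\<And>x. x \<in> S \<Longrightarrow> \<pi>' (\<pi> x) = x" "\<And>x. x \<in> S \<Longrightarrow> \<pi> (\<pi>' x) = x"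
    and m: "\<And>x y. x \<in> S \<Longrightarrow> y \<in> S \<Longrightarrow> m (\<pi> x) (\<pi> y) = m x y"
  shows "presentation_symmetry S (weyl_monoid_rels S m) \<pi> \<pi>'"
    and "presentation_symmetry (S \<times> UNIV) (group_rels (weyl_group_rels S m))
      (map_prod \<pi> id) (map_prod \<pi>' id)"
proof -
  have m': "m (\<pi>' x) (\<pi>' y) = m x y" if "x \<in> S" "y \<in> S" for x y
    using m[of "\<pi>' x" "\<pi>' y"] that into inverse by simp
  have monoid: "(map \<sigma> u, map \<sigma> v) \<in> weyl_monoid_rels S m"
    if uv: "(u, v) \<in> weyl_monoid_rels S m" and sym: "\<And>x. x \<in> S \<Longrightarrow> \<sigma> x \<in> S" "inj_on \<sigma> S"
      "\<And>x y. x \<in> S \<Longrightarrow> y \<in> S \<Longrightarrow> m (\<sigma> x) (\<sigma> y) = m x y" for u v \<sigma>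
  proof -
    consider a where "a \<in> S" "u = [a, a]" "v = [a]"
      | a b where "a \<in> S" "b \<in> S" "a \<noteq> b" "u = alt_word (m a b) a b" "v = alt_word (m a b) b a"
      using uv by (auto simp: weyl_monoid_rels_def)
    then show ?thesis
    proof cases
      case (2 a b)
      then have "\<sigma> a \<noteq> \<sigma> b" using sym(2) by (auto dest: inj_onD)
      then have "(alt_word (m (\<sigma> a) (\<sigma> b)) (\<sigma> a) (\<sigma> b), alt_word (m (\<sigma> a) (\<sigma> b)) (\<sigma> b) (\<sigma> a))
          \<in> weyl_monoid_rels S m"
        using sym(1) 2 unfolding weyl_monoid_rels_def by blast
      then show ?thesis using 2 sym(3) by (simp add: map_alt_word)
    qed (use sym(1) in \<open>auto simp: weyl_monoid_rels_def\<close>)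
  qed
  have rel: "map (map_prod \<sigma> id) u \<in> weyl_group_rels S m"
    if u: "u \<in> weyl_group_rels S m" and sym: "\<And>x. x \<in> S \<Longrightarrow> \<sigma> x \<in> S" "inj_on \<sigma> S"
      "\<And>x y. x \<in> S \<Longrightarrow> y \<in> S \<Longrightarrow> m (\<sigma> x) (\<sigma> y) = m x y" for u \<sigma>
  proof -
    consider a where "a \<in> S" "u = [(a, True), (a, True)]"
      | a b where "a \<in> S" "b \<in> S" "a \<noteq> b" "u = concat (replicate (m a b) [(a, True), (b, True)])"
      using u by (auto simp: weyl_group_rels_def)
    then show ?thesis
    proof cases
      case (2 a b)
      then have "\<sigma> a \<noteq> \<sigma> b" using sym(2) by (auto dest: inj_onD)
      then have "concat (replicate (m (\<sigma> a) (\<sigma> b)) [(\<sigma> a, True), (\<sigma> b, True)]) \<in> weyl_group_rels S m"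
        using sym(1) 2 unfolding weyl_group_rels_def by blast
      then show ?thesis using 2 sym(3) by (simp add: map_concat)
    qed (use sym(1) in \<open>auto simp: weyl_group_rels_def\<close>)
  qed
  have group: "(map (map_prod \<sigma> id) u, map (map_prod \<sigma> id) v) \<in> group_rels (weyl_group_rels S m)"
    if "(u, v) \<in> group_rels (weyl_group_rels S m)" "\<And>x. x \<in> S \<Longrightarrow> \<sigma> x \<in> S" "inj_on \<sigma> S"
      "\<And>x y. x \<in> S \<Longrightarrow> y \<in> S \<Longrightarrow> m (\<sigma> x) (\<sigma> y) = m x y" for u v \<sigma>
    using that(1) rel[of u \<sigma>, OF _ that(2-4)] by (auto simp: group_rels_def)
  have inj: "inj_on \<pi> S" "inj_on \<pi>' S"
    using inverse by (auto intro: inj_on_inverseI)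
  show "presentation_symmetry S (weyl_monoid_rels S m) \<pi> \<pi>'"
    by unfold_locales
      (use into inverse monoid[OF _ into(1) inj(1) m] monoid[OF _ into(2) inj(2) m'] in auto)
  show "presentation_symmetry (S \<times> UNIV) (group_rels (weyl_group_rels S m))
      (map_prod \<pi> id) (map_prod \<pi>' id)"
    by unfold_locales
      (use into inverse group[OF _ into(1) inj(1) m] group[OF _ into(2) inj(2) m'] in auto)
qed

section \<open>Symmetries of the quiver\<close>

context quiver_action
begin

lemma group_G: "group G"
  using vertices.group_hom by (rule group_hom.axioms(1))

lemma act_closed: "g \<in> carrier G \<Longrightarrow> i \<in> verts Q \<Longrightarrow> \<alpha> g i \<in> verts Q"
  by (rule vertices.element_image) auto

lemma act_inv:
  assumes "g \<in> carrier G" "i \<in> verts Q"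
  shows "\<alpha> (inv\<^bsub>G\<^esub> g) (\<alpha> g i) = i" "\<alpha> g (\<alpha> (inv\<^bsub>G\<^esub> g) i) = i"
proof -
  show "\<alpha> (inv\<^bsub>G\<^esub> g) (\<alpha> g i) = i" using vertices.orbit_sym_aux assms by blast
  show "\<alpha> g (\<alpha> (inv\<^bsub>G\<^esub> g) i) = i"
    using vertices.orbit_sym_aux[of "inv\<^bsub>G\<^esub> g" i] assms group.inv_inv[OF group_G]
      group.inv_closed[OF group_G] by simp
qed

lemma arrows_between_act:
  assumes g: "g \<in> carrier G" and ij: "i \<in> verts Q" "j \<in> verts Q"
  shows "arrows_between Q {\<alpha> g i} {\<alpha> g j} = arrows_between Q {i} {j}"
proof -
  define E where "E i j = {e \<in> arcs Q.
     tail Q e \<in> {i} \<and> head Q e \<in> {j} \<or> tail Q e \<in> {j} \<and> head Q e \<in> {i}}" for i j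
  have le: "card (E i j) \<le> card (E (\<alpha> g i) (\<alpha> g j))"
    if "g \<in> carrier G" "i \<in> verts Q" "j \<in> verts Q" for g i j
  proof (rule card_inj_on_le[of "\<beta> g"])
    show "inj_on (\<beta> g) (E i j)"
      by (rule inj_on_subset[OF arrows.inj_prop[OF that(1)]]) (auto simp: E_def)
    show "\<beta> g ` E i j \<subseteq> E (\<alpha> g i) (\<alpha> g j)"
      using that arrows.element_image[OF that(1)] by (auto simp: E_def tail_action head_action)
    show "finite (E (\<alpha> g i) (\<alpha> g j))" by (simp add: E_def)
  qed
  have "card (E i j) = card (E (\<alpha> g i) (\<alpha> g j))"
    using le[OF g ij] le[of "inv\<^bsub>G\<^esub> g" "\<alpha> g i" "\<alpha> g j"] g ij
      group.inv_closed[OF group_G g] act_closed act_inv by (simp add: le_antisym)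
  then show ?thesis by (simp add: arrows_between_def E_def)
qed

lemma quiver_exp_act:
  "g \<in> carrier G \<Longrightarrow> i \<in> verts Q \<Longrightarrow> j \<in> verts Q \<Longrightarrow> quiver_exp Q (\<alpha> g i) (\<alpha> g j) = quiver_exp Q i j"
  by (simp add: quiver_exp_def arrows_between_act)

lemma
  assumes "g \<in> carrier G"
  shows symmetry_WMQ: "presentation_symmetry (verts Q) (weyl_monoid_rels (verts Q) (quiver_exp Q))
      (\<alpha> g) (\<alpha> (inv\<^bsub>G\<^esub> g))"
    and symmetry_WQ: "presentation_symmetry (verts Q \<times> UNIV)
      (group_rels (weyl_group_rels (verts Q) (quiver_exp Q)))
      (map_prod (\<alpha> g) id) (map_prod (\<alpha> (inv\<^bsub>G\<^esub> g)) id)"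
proof -
  note g = assms group.inv_closed[OF group_G assms]
  note symmetry = weyl_presentation_symmetry[where S = "verts Q" and m = "quiver_exp Q" and \<pi> = "\<alpha> g"
    and \<pi>' = "\<alpha> (inv\<^bsub>G\<^esub> g)", OF act_closed[OF g(1)] act_closed[OF g(2)]
    act_inv[OF g(1)] quiver_exp_act[OF g(1)]]
  show "presentation_symmetry (verts Q) (weyl_monoid_rels (verts Q) (quiver_exp Q))
      (\<alpha> g) (\<alpha> (inv\<^bsub>G\<^esub> g))"
    by (rule symmetry(1))
  show "presentation_symmetry (verts Q \<times> UNIV)
      (group_rels (weyl_group_rels (verts Q) (quiver_exp Q)))
      (map_prod (\<alpha> g) id) (map_prod (\<alpha> (inv\<^bsub>G\<^esub> g)) id)"
    by (rule symmetry(2))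
qed

lemma WQ_act_hom: "g \<in> carrier G \<Longrightarrow> WQ_act \<alpha> g \<in> hom (WQ Q) (WQ Q)"
  using presentation_symmetry.image_hom[OF symmetry_WQ]
  by (simp add: WQ_act_def[abs_def] weyl_group_def presented_group_def)

lemma WMQ_act_hom: "g \<in> carrier G \<Longrightarrow> WMQ_act \<alpha> g \<in> hom (WMQ Q) (WMQ Q)"
  using presentation_symmetry.image_hom[OF symmetry_WMQ]
  by (simp add: WMQ_act_def[abs_def] weyl_monoid_def)

lemma WMQ_act_one: "g \<in> carrier G \<Longrightarrow> WMQ_act \<alpha> g \<one>\<^bsub>WMQ Q\<^esub> = \<one>\<^bsub>WMQ Q\<^esub>"
  using presentation_symmetry.image_one[OF symmetry_WMQ]
  by (simp add: WMQ_act_def weyl_monoid_def)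

lemma WQ_act_gen: "g \<in> carrier G \<Longrightarrow> i \<in> verts Q \<Longrightarrow>
    WQ_act \<alpha> g (weyl_gen (verts Q) (quiver_exp Q) i) = weyl_gen (verts Q) (quiver_exp Q) (\<alpha> g i)"
  using presentation_symmetry.image_class[OF symmetry_WQ, of g "[(i, True)]"]
  by (simp add: WQ_act_def weyl_gen_def)

lemma WMQ_act_gen: "g \<in> carrier G \<Longrightarrow> i \<in> verts Q \<Longrightarrow>
    WMQ_act \<alpha> g (weyl_monoid_gen (verts Q) (quiver_exp Q) i) =
      weyl_monoid_gen (verts Q) (quiver_exp Q) (\<alpha> g i)"
  using presentation_symmetry.image_class[OF symmetry_WMQ, of g "[i]"]
  by (simp add: WMQ_act_def weyl_monoid_gen_def)

lemma WQ_act_inverse: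
  "g \<in> carrier G \<Longrightarrow> X \<in> carrier (WQ Q) \<Longrightarrow> WQ_act \<alpha> (inv\<^bsub>G\<^esub> g) (WQ_act \<alpha> g X) = X"
  using presentation_symmetry.image_inverse[OF symmetry_WQ]
  by (simp add: WQ_act_def weyl_group_def presented_group_def)

text \<open>Neither \<open>g\<close> nor its inverse increases length, so the action preserves it and \<open>\<rho>Q\<close> is
  equivariant; being injective, \<open>\<rho>Q\<close> also reflects invariance.\<close>
lemma rho_invariant_iff:
  assumes "tsaranov_bijection (verts Q) (quiver_exp Q) \<rho>Q" "X \<in> carrier (WQ Q)"
  shows "\<rho>Q X \<in> carrier (WMQ_inv G Q \<alpha>) \<longleftrightarrow> X \<in> carrier (WQ_inv G Q \<alpha>)"
proof -
  interpret tsaranov_system "WQ Q" "WMQ Q" "verts Q" "weyl_gen (verts Q) (quiver_exp Q)"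
    "weyl_monoid_gen (verts Q) (quiver_exp Q)" \<rho>Q
    by (rule tsaranov_system_weyl[OF assms(1)])
  have "WMQ_act \<alpha> g (\<rho>Q X) = \<rho>Q X \<longleftrightarrow> WQ_act \<alpha> g X = X" if g: "g \<in> carrier G" for g
  proof -
    have g': "inv\<^bsub>G\<^esub> g \<in> carrier G" using g by (rule group.inv_closed[OF group_G])
    have pi: "\<alpha> k \<in> verts Q \<rightarrow> verts Q" if "k \<in> carrier G" for k
      using act_closed[OF that] by auto
    have gX: "WQ_act \<alpha> g X \<in> carrier (WQ Q)"
      using WQ_act_hom[OF g] assms(2) by (rule hom_in_carrier)
    have "len (WQ_act \<alpha> g X) \<le> len X"
      by (rule len_hom_le[OF WQ_act_hom[OF g] pi[OF g] WQ_act_gen[OF g] assms(2)])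
    moreover have "len (WQ_act \<alpha> (inv\<^bsub>G\<^esub> g) (WQ_act \<alpha> g X)) \<le> len (WQ_act \<alpha> g X)"
      by (rule len_hom_le[OF WQ_act_hom[OF g'] pi[OF g'] WQ_act_gen[OF g'] gX])
    ultimately have same_len: "len (WQ_act \<alpha> g X) = len X"
      unfolding WQ_act_inverse[OF g assms(2)] by (rule le_antisym)
    have "\<rho>Q (WQ_act \<alpha> g X) = WMQ_act \<alpha> g (\<rho>Q X)"
      by (rule rho_equivariant[OF WQ_act_hom[OF g] pi[OF g] WQ_act_gen[OF g]
        WMQ_act_hom[OF g] WMQ_act_one[OF g] WMQ_act_gen[OF g] assms(2) same_len])
    then show ?thesis using inj_on_eq_iff[OF rho_inj gX assms(2)] by simp
  qed
  then show ?thesis using assms(2) by (simp add: WMQ_inv_def WQ_inv_def)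
qed

lemma folding_system_quiver:
  assumes Q: "tsaranov_bijection (verts Q) (quiver_exp Q) \<rho>Q"
    and C: "tsaranov_bijection (orbits G (verts Q) \<alpha>) (cartan_exp Q) \<rho>C"
    and fold: "folding_iso G Q \<alpha> \<psi>"
  shows "folding_system (WC G Q \<alpha>) (WMC G Q \<alpha>) (orbits G (verts Q) \<alpha>)
    (weyl_gen (orbits G (verts Q) \<alpha>) (cartan_exp Q))
    (weyl_monoid_gen (orbits G (verts Q) \<alpha>) (cartan_exp Q)) \<rho>C
    (WQ Q) (WMQ Q) (verts Q) (weyl_gen (verts Q) (quiver_exp Q))
    (weyl_monoid_gen (verts Q) (quiver_exp Q)) \<rho>Q \<psi> (carrier G) \<alpha> (WQ_act \<alpha>)"
proof (rule folding_system.intro[OF tsaranov_system_weyl[OF C] tsaranov_system_weyl[OF Q]],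
    unfold_locales)
  have iso: "\<psi> \<in> iso (WC G Q \<alpha>) (WQ_inv G Q \<alpha>)" using fold by (simp add: folding_iso_def)
  have memb: "\<exists>x\<in>verts Q. A = {\<alpha> g x | g. g \<in> carrier G}" if "A \<in> orbits G (verts Q) \<alpha>" for A
    using that by (auto simp: orbits_def orbit_def)
  show sub: "A \<subseteq> verts Q" if "A \<in> orbits G (verts Q) \<alpha>" for A
    using memb[OF that] act_closed by auto
  show "finite A" if "A \<in> orbits G (verts Q) \<alpha>" for A
    by (rule finite_subset[OF sub[OF that] finite_verts])
  show "A \<noteq> {}" if "A \<in> orbits G (verts Q) \<alpha>" for A
    using memb[OF that] monoid.one_closed[OF group.is_monoid[OF group_G]] by blast
  show "inj_on (weyl_gen (verts Q) (quiver_exp Q)) (verts Q)"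
    by (rule weyl_gen_inj[OF Q]) (simp add: quiver_exp_def)
  show "\<alpha> g \<in> verts Q \<rightarrow> verts Q" if "g \<in> carrier G" for g
    using act_closed[OF that] by auto
  show "\<alpha> g i \<in> A" if g: "g \<in> carrier G" and A: "A \<in> orbits G (verts Q) \<alpha>" "i \<in> A" for g A i
  proof -
    obtain x k where x: "x \<in> verts Q" "A = {\<alpha> g x | g. g \<in> carrier G}" "k \<in> carrier G" "i = \<alpha> k x"
      using memb[OF A(1)] A(2) by auto
    then have "\<alpha> g i = \<alpha> (g \<otimes>\<^bsub>G\<^esub> k) x" using vertices.composition_rule[OF x(1) g x(3)] by simp
    moreover have "g \<otimes>\<^bsub>G\<^esub> k \<in> carrier G"
      using g x(3) by (rule monoid.m_closed[OF group.is_monoid[OF group_G]])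
    ultimately show ?thesis unfolding x(2) by blast
  qed
  show "\<exists>g\<in>carrier G. \<alpha> g i = j" if A: "A \<in> orbits G (verts Q) \<alpha>" "i \<in> A" "j \<in> A" for A i j
  proof -
    obtain x where x: "x \<in> verts Q" "A = {\<alpha> g x | g. g \<in> carrier G}" using memb[OF A(1)] by blast
    obtain k where k: "k \<in> carrier G" "i = \<alpha> k x" using A(2) x(2) by blast
    obtain l where l: "l \<in> carrier G" "j = \<alpha> l x" using A(3) x(2) by blast
    have k': "inv\<^bsub>G\<^esub> k \<in> carrier G" using k(1) by (rule group.inv_closed[OF group_G])
    have "\<alpha> (l \<otimes>\<^bsub>G\<^esub> inv\<^bsub>G\<^esub> k) i = j"
      using vertices.composition_rule[OF act_closed[OF k(1) x(1)] l(1) k'] act_inv(1)[OF k(1) x(1)] k l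
      by simp
    moreover have "l \<otimes>\<^bsub>G\<^esub> inv\<^bsub>G\<^esub> k \<in> carrier G"
      using l(1) k' by (rule monoid.m_closed[OF group.is_monoid[OF group_G]])
    ultimately show ?thesis by blast
  qed
  show "WQ_act \<alpha> g \<in> hom (WQ Q) (WQ Q)" if "g \<in> carrier G" for g
    by (rule WQ_act_hom[OF that])
  show "WQ_act \<alpha> g (weyl_gen (verts Q) (quiver_exp Q) i) = weyl_gen (verts Q) (quiver_exp Q) (\<alpha> g i)"
    if "g \<in> carrier G" "i \<in> verts Q" for g i
    by (rule WQ_act_gen[OF that])
  show "\<psi> \<in> hom (WC G Q \<alpha>) (WQ Q)"
    using iso by (auto simp: iso_def hom_def WQ_inv_def Pi_iff)
  show "inj_on \<psi> (carrier (WC G Q \<alpha>))" using iso by (simp add: iso_def bij_betw_def)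
  show "WQ_act \<alpha> g (\<psi> w) = \<psi> w" if "g \<in> carrier G" "w \<in> carrier (WC G Q \<alpha>)" for g w
    using iso that by (auto simp: iso_def hom_def WQ_inv_def Pi_iff)
  show "\<psi> (weyl_gen (orbits G (verts Q) \<alpha>) (cartan_exp Q) A) =
      word_prod (WQ Q) (weyl_gen (verts Q) (quiver_exp Q)) is"
    if "A \<in> orbits G (verts Q) \<alpha>" "distinct is" "set is = A" for A "is"
    using fold that by (simp add: folding_iso_def)
qed

end

section \<open>The isomorphism of Weyl monoids\<close>

theorem proposition5p4:
  fixes G :: "('g, 'k) monoid_scheme" and Q :: "('v, 'e) pre_digraph"
    and \<alpha> :: "'g \<Rightarrow> 'v \<Rightarrow> 'v" and \<beta> :: "'g \<Rightarrow> 'e \<Rightarrow> 'e"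
    and \<rho>Q :: "('v \<times> bool) list set \<Rightarrow> 'v list set"
    and \<rho>C :: "('v set \<times> bool) list set \<Rightarrow> 'v set list set"
    and \<psi> :: "('v set \<times> bool) list set \<Rightarrow> ('v \<times> bool) list set"
  assumes "quiver_action G Q \<alpha> \<beta>"
    and "tsaranov_bijection (verts Q) (quiver_exp Q) \<rho>Q"
    and "tsaranov_bijection (orbits G (verts Q) \<alpha>) (cartan_exp Q) \<rho>C"
    and "folding_iso G Q \<alpha> \<psi>"
  shows "\<exists>!\<psi>'. \<psi>' \<in> iso (WMC G Q \<alpha>) (WMQ_inv G Q \<alpha>) \<inter> extensional (carrier (WMC G Q \<alpha>)) \<and>
           (\<forall>w\<in>carrier (WC G Q \<alpha>). \<psi>' (\<rho>C w) = \<rho>Q (\<psi> w))"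
proof -
  interpret quiver_action G Q \<alpha> \<beta> by (rule assms(1))
  interpret folding_system "WC G Q \<alpha>" "WMC G Q \<alpha>" "orbits G (verts Q) \<alpha>"
    "weyl_gen (orbits G (verts Q) \<alpha>) (cartan_exp Q)"
    "weyl_monoid_gen (orbits G (verts Q) \<alpha>) (cartan_exp Q)" \<rho>C
    "WQ Q" "WMQ Q" "verts Q" "weyl_gen (verts Q) (quiver_exp Q)"
    "weyl_monoid_gen (verts Q) (quiver_exp Q)" \<rho>Q \<psi> "carrier G" \<alpha> "WQ_act \<alpha>"
    by (rule folding_system_quiver[OF assms(2-4)])
  let ?WC = "carrier (WC G Q \<alpha>)" and ?WMC = "carrier (WMC G Q \<alpha>)"
  let ?WQ = "carrier (WQ_inv G Q \<alpha>)" and ?WMQ = "carrier (WMQ_inv G Q \<alpha>)"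
  have C: "bij_betw \<rho>C ?WC ?WMC" using assms(3) by (simp add: tsaranov_bijection_def)
  have Q: "bij_betw \<rho>Q (carrier (WQ Q)) (carrier (WMQ Q))"
    using assms(2) by (simp add: tsaranov_bijection_def)
  have P: "bij_betw \<psi> ?WC ?WQ" using assms(4) by (simp add: folding_iso_def iso_def)
  have sub: "?WQ \<subseteq> carrier (WQ Q)" "?WMQ \<subseteq> carrier (WMQ Q)"
    by (auto simp: WQ_inv_def WMQ_inv_def)
  have "\<rho>Q ` ?WQ = ?WMQ"
  proof
    show "\<rho>Q ` ?WQ \<subseteq> ?WMQ" using rho_invariant_iff[OF assms(2)] sub(1) by blast
    show "?WMQ \<subseteq> \<rho>Q ` ?WQ"
    proof
      fix Y assume Y: "Y \<in> ?WMQ"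
      then obtain X where "X \<in> carrier (WQ Q)" "Y = \<rho>Q X"
        using bij_betw_imp_surj_on[OF Q] sub(2) by blast
      then show "Y \<in> \<rho>Q ` ?WQ" using Y rho_invariant_iff[OF assms(2)] by blast
    qed
  qed
  then have Q_inv: "bij_betw \<rho>Q ?WQ ?WMQ"
    using inj_on_subset[OF bij_betw_imp_inj_on[OF Q] sub(1)] by (simp add: bij_betw_def)
  define \<theta> where "\<theta> = restrict (\<lambda>x. \<rho>Q (\<psi> (inv_into ?WC \<rho>C x))) ?WMC"
  have \<theta>: "\<theta> (\<rho>C w) = \<rho>Q (\<psi> w)" if "w \<in> ?WC" for w
    using that bij_betwE[OF C] bij_betw_inv_into_left[OF C that] by (simp add: \<theta>_def)
  have onto: "\<exists>w\<in>?WC. x = \<rho>C w" if "x \<in> ?WMC" for x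
    using that bij_betw_imp_surj_on[OF C] by blast
  have "bij_betw (\<rho>Q \<circ> (\<psi> \<circ> inv_into ?WC \<rho>C)) ?WMC ?WMQ"
    by (rule bij_betw_trans[OF bij_betw_trans[OF bij_betw_inv_into[OF C] P] Q_inv])
  then have bij: "bij_betw \<theta> ?WMC ?WMQ"
    by (rule bij_betw_cong[THEN iffD1, rotated]) (simp add: \<theta>_def)
  have "\<theta> \<in> hom (WMC G Q \<alpha>) (WMQ_inv G Q \<alpha>)"
  proof (rule homI)
    show "\<theta> x \<in> ?WMQ" if "x \<in> ?WMC" for x
      using bij that by (rule bij_betw_apply)
    show "\<theta> (x \<otimes>\<^bsub>WMC G Q \<alpha>\<^esub> y) = \<theta> x \<otimes>\<^bsub>WMQ_inv G Q \<alpha>\<^esub> \<theta> y"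
      if xy: "x \<in> ?WMC" "y \<in> ?WMC" for x y
    proof -
      obtain w1 w2 where w12: "w1 \<in> ?WC" "x = \<rho>C w1" "w2 \<in> ?WC" "y = \<rho>C w2"
        using onto xy by metis
      obtain w where w: "w \<in> ?WC" "\<rho>C w = x \<otimes>\<^bsub>WMC G Q \<alpha>\<^esub> y"
          "\<rho>Q (\<psi> w) = \<rho>Q (\<psi> w1) \<otimes>\<^bsub>WMQ Q\<^esub> \<rho>Q (\<psi> w2)"
        using fold_mult[OF w12(1,3)] w12(2,4) by blast
      have "\<theta> (x \<otimes>\<^bsub>WMC G Q \<alpha>\<^esub> y) = \<theta> x \<otimes>\<^bsub>WMQ Q\<^esub> \<theta> y"
        unfolding w(2)[symmetric] using \<theta> w(1,3) w12 by simp
      then show ?thesis by (simp add: WMQ_inv_def)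
    qed
  qed
  then have iso: "\<theta> \<in> iso (WMC G Q \<alpha>) (WMQ_inv G Q \<alpha>)" using bij by (simp add: iso_def)
  show ?thesis
  proof (rule ex1I[of _ \<theta>])
    show "\<theta> \<in> iso (WMC G Q \<alpha>) (WMQ_inv G Q \<alpha>) \<inter> extensional ?WMC \<and>
        (\<forall>w\<in>?WC. \<theta> (\<rho>C w) = \<rho>Q (\<psi> w))"
      using iso \<theta> by (simp add: \<theta>_def)
  next
    fix \<theta>'
    assume "\<theta>' \<in> iso (WMC G Q \<alpha>) (WMQ_inv G Q \<alpha>) \<inter> extensional ?WMC \<and>
        (\<forall>w\<in>?WC. \<theta>' (\<rho>C w) = \<rho>Q (\<psi> w))"
    then have \<theta>': "\<theta>' \<in> extensional ?WMC" "\<And>w. w \<in> ?WC \<Longrightarrow> \<theta>' (\<rho>C w) = \<rho>Q (\<psi> w)" by auto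
    show "\<theta>' = \<theta>"
    proof (rule extensionalityI[OF \<theta>'(1)])
      show "\<theta> \<in> extensional ?WMC" by (simp add: \<theta>_def)
      show "\<theta>' x = \<theta> x" if "x \<in> ?WMC" for x
        using onto[OF that] \<theta> \<theta>'(2) by auto
    qed
  qed
qed

end
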